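(* Let $p$ be an odd prime and let $D\in\mathbb{Z}$ be not a perfect square, such that $D$ has a square root $\sqrt{D}$ in $\mathbb{Q}_p$. If $\sqrt{D}$ has a periodic continued fraction expansion with Browkin II, then the preperiod length of this expansion is either one or even.
   Context: Let $p$ be an odd prime, and let $v_p$ be the $p$-adic valuation on $\mathbb{Q}_p$. Every $\alpha\in\mathbb{Q}_p$ is written uniquely as $\alpha=\sum_{n=-r}^{+\infty}a_np^n$ with $r\in\mathbb{Z}$ and digits $a_n\in\{-\frac{p-1}{2},\ldots,\frac{p-1}{2}\}$. Define $s(\alpha)=\sum_{n=-r}^{0}a_np^n\in\mathbb{Q}$ and $t(\alpha)=\sum_{n=-r}^{-1}a_np^n\in\mathbb{Q}$ (empty sums are $0$), and let $\mathrm{sign}$ be the usual sign function on $\mathbb{Q}$. The algorithm Browkin II, started at $\alpha_0=\alpha\in\mathbb{Q}_p$, computes for $n\ge 0$: $b_n=s(\alpha_n)$ if $n$ is even; $b_n=t(\alpha_n)$ if $n$ is odd and $v_p(\alpha_n-t(\alpha_n))=0$; $b_n=t(\alpha_n)-\mathrm{sign}(t(\alpha_n))$ if $n$ is odd and $v_p(\alpha_n-t(\alpha_n))\neq 0$; and $\alpha_{n+1}=\frac{1}{\alpha_n-b_n}$ (stopping if $\alpha_n=b_n$). The sequence $[b_0,b_1,\ldots]$ is the Browkin II expansion of $\alpha$. An infinite expansion is periodic if there are $h\ge 0$ and $k\ge 1$ with $b_{n+k}=b_n$ for all $n\ge h$. The preperiod length is the smallest $h\geq 0$ for which such a $k$ exists.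 *)

theory Defs
  imports
    Complex_Main
    "HOL-Computational_Algebra.Primes"
    "HOL-Library.Extended"
    "Berlekamp_Zassenhaus.Finite_Field"
begin

section \<open>The \<open>p\<close>-adic absolute value on the rationals\<close>

definition rat_val :: "nat \<Rightarrow> rat \<Rightarrow> int" where
  "rat_val p x =
     int (multiplicity (int p) (fst (quotient_of x))) -
     int (multiplicity (int p) (snd (quotient_of x)))"

definition rat_abs :: "nat \<Rightarrow> rat \<Rightarrow> real" where
  "rat_abs p x = (if x = 0 then 0 else real p powi (- rat_val p x))"

lemma rat_abs_0 [simp]: "rat_abs p 0 = 0"
  by (simp add: rat_abs_def)

context
  fixes p :: nat
  assumes p: "prime p"
begin

lemma rat_val_divide:
  assumes "a \<noteq> 0" "b \<noteq> 0"
  shows "rat_val p (of_int a / of_int b) =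
           int (multiplicity (int p) a) - int (multiplicity (int p) b)"
proof -
  have pe: "prime_elem (int p)" using p by simp
  obtain c d where cd: "quotient_of (of_int a / of_int b) = (c, d)"
    by (cases "quotient_of (of_int a / of_int b)")
  have d: "d > 0" using quotient_of_denom_pos[OF cd] .
  have eq: "of_int a / of_int b = (of_int c / of_int d :: rat)"
    using quotient_of_div[OF cd] .
  hence "of_int (a * d) = (of_int (c * b) :: rat)"
    using assms d by (simp add: field_simps)
  hence eq': "a * d = c * b" by (simp only: of_int_eq_iff)
  have "c \<noteq> 0" using eq' assms d by auto
  have "multiplicity (int p) (a * d) = multiplicity (int p) a + multiplicity (int p) d"
    using assms d by (intro prime_elem_multiplicity_mult_distrib[OF pe]) auto
  moreover have "multiplicity (int p) (c * b) = multiplicity (int p) c + multiplicity (int p) b"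
    using assms \<open>c \<noteq> 0\<close> by (intro prime_elem_multiplicity_mult_distrib[OF pe]) auto
  ultimately have "int (multiplicity (int p) a) + int (multiplicity (int p) d) =
      int (multiplicity (int p) c) + int (multiplicity (int p) b)"
    using eq' by (metis of_nat_add)
  thus ?thesis unfolding rat_val_def cd by simp
qed

lemma rat_val_of_int: "a \<noteq> 0 \<Longrightarrow> rat_val p (of_int a) = int (multiplicity (int p) a)"
  using rat_val_divide[of a 1] by simp

lemma rat_cases_nz:
  fixes x :: rat
  assumes "x \<noteq> 0"
  obtains a b where "a \<noteq> 0" "b \<noteq> 0" "x = of_int a / of_int b"
proof -
  obtain a b where ab: "quotient_of x = (a, b)" by (cases "quotient_of x")
  have "x = of_int a / of_int b" using quotient_of_div[OF ab] .
  moreover have "b \<noteq> 0" using quotient_of_denom_pos[OF ab] by simp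
  moreover have "a \<noteq> 0" using calculation assms by auto
  ultimately show thesis using that by blast
qed

lemma rat_val_mult:
  assumes "x \<noteq> 0" "y \<noteq> 0"
  shows "rat_val p (x * y) = rat_val p x + rat_val p y"
proof -
  have pe: "prime_elem (int p)" using p by simp
  obtain a b where ab: "a \<noteq> 0" "b \<noteq> 0" "x = of_int a / of_int b"
    using rat_cases_nz[OF assms(1)] .
  obtain c d where cd: "c \<noteq> 0" "d \<noteq> 0" "y = of_int c / of_int d"
    using rat_cases_nz[OF assms(2)] .
  have "x * y = of_int (a * c) / of_int (b * d)" by (simp add: ab cd)
  hence "rat_val p (x * y) =
      int (multiplicity (int p) (a * c)) - int (multiplicity (int p) (b * d))"
    using rat_val_divide[of "a * c" "b * d"] ab cd by simp
  thus ?thesis using ab cd pe rat_val_divide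
    by (simp add: prime_elem_multiplicity_mult_distrib)
qed

lemma rat_val_add:
  assumes "x \<noteq> 0" "y \<noteq> 0" "x + y \<noteq> 0"
  shows "rat_val p (x + y) \<ge> min (rat_val p x) (rat_val p y)"
proof -
  have pe: "prime_elem (int p)" using p by simp
  have np: "\<not> is_unit (int p)" using p by auto
  obtain a b where ab: "a \<noteq> 0" "b \<noteq> 0" "x = of_int a / of_int b"
    using rat_cases_nz[OF assms(1)] .
  obtain c d where cd: "c \<noteq> 0" "d \<noteq> 0" "y = of_int c / of_int d"
    using rat_cases_nz[OF assms(2)] .
  let ?m = "multiplicity (int p)"
  define k where "k = min (?m (a * d)) (?m (c * b))"
  have xy: "x + y = of_int (a * d + c * b) / of_int (b * d)" 
    using ab cd by (simp add: field_simps)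
  have nz: "a * d + c * b \<noteq> 0"
  proof
    assume 0: "a * d + c * b = 0"
    show False using assms(3) unfolding xy 0 by simp
  qed
  have "int p ^ k dvd a * d + c * b" unfolding k_def
    by (intro dvd_add multiplicity_dvd') auto
  hence "k \<le> ?m (a * d + c * b)"
    using nz np by (intro multiplicity_geI) auto
  moreover have "rat_val p (x + y) = int (?m (a * d + c * b)) - int (?m (b * d))"
    unfolding xy using nz ab cd by (intro rat_val_divide) auto
  moreover have "rat_val p x = int (?m (a * d)) - int (?m (b * d))"
    using ab cd pe rat_val_divide[of a b] by (simp add: prime_elem_multiplicity_mult_distrib)
  moreover have "rat_val p y = int (?m (c * b)) - int (?m (b * d))"
    using ab cd pe rat_val_divide[of c d] by (simp add: prime_elem_multiplicity_mult_distrib)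
  ultimately show ?thesis unfolding k_def by linarith
qed

lemma p_gt_1: "real p > 1"
  using prime_gt_1_nat[OF p] by simp

lemma rat_abs_nonneg [simp]: "rat_abs p x \<ge> 0"
  by (simp add: rat_abs_def)

lemma rat_abs_eq_0_iff [simp]: "rat_abs p x = 0 \<longleftrightarrow> x = 0"
  using p_gt_1 by (simp add: rat_abs_def)

lemma rat_abs_mult: "rat_abs p (x * y) = rat_abs p x * rat_abs p y"
  using p_gt_1 by (simp add: rat_abs_def rat_val_mult flip: power_int_add)

lemma rat_abs_1 [simp]: "rat_abs p 1 = 1"
  by (simp add: rat_abs_def rat_val_def)

lemma rat_abs_minus [simp]: "rat_abs p (- x) = rat_abs p x"
proof -
  have "rat_abs p (-1) * rat_abs p (-1) = 1"
    using rat_abs_mult[of "-1" "-1"] by simp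
  hence "rat_abs p (-1) = 1"
    using rat_abs_nonneg[of "-1"] by (metis abs_of_nonneg abs_1 abs_mult_self_eq real_sqrt_abs2 real_sqrt_one)
  thus ?thesis using rat_abs_mult[of "-1" x] by simp
qed

lemma rat_abs_minus_commute: "rat_abs p (x - y) = rat_abs p (y - x)"
  using rat_abs_minus[of "x - y"] by simp

lemma rat_abs_inverse: "rat_abs p (inverse x) = inverse (rat_abs p x)"
proof (cases "x = 0")
  case False
  hence "rat_abs p x * rat_abs p (inverse x) = 1"
    using rat_abs_mult[of x "inverse x"] by simp
  thus ?thesis using False by (simp add: field_simps)
qed simp

lemma rat_abs_ultra: "rat_abs p (x + y) \<le> max (rat_abs p x) (rat_abs p y)"
proof (cases "x = 0 \<or> y = 0 \<or> x + y = 0")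
  case True
  thus ?thesis by (auto simp: le_max_iff_disj)
next
  case False
  hence "min (rat_val p x) (rat_val p y) \<le> rat_val p (x + y)"
    using rat_val_add by blast
  hence "- rat_val p (x + y) \<le> max (- rat_val p x) (- rat_val p y)" by linarith
  hence "real p powi (- rat_val p (x + y)) \<le> real p powi (max (- rat_val p x) (- rat_val p y))"
    using p_gt_1 by (intro power_int_increasing) auto
  also have "\<dots> \<le> max (real p powi (- rat_val p x)) (real p powi (- rat_val p y))"
    by (cases "- rat_val p x \<le> - rat_val p y") (auto simp: max_def)
  finally show ?thesis using False by (simp add: rat_abs_def)
qed

lemma rat_abs_triangle: "rat_abs p (x + y) \<le> rat_abs p x + rat_abs p y"
  using rat_abs_ultra[of x y] rat_abs_nonneg[of x] rat_abs_nonneg[of y] by linarith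

lemma rat_abs_triangle': "\<bar>rat_abs p x - rat_abs p y\<bar> \<le> rat_abs p (x - y)"
  using rat_abs_triangle[of "x - y" y] rat_abs_triangle[of "y - x" x]
    rat_abs_minus_commute[of x y] by auto

end


section \<open>\<open>p\<close>-adic Cauchy sequences of rationals\<close>

definition padic_null :: "nat \<Rightarrow> (nat \<Rightarrow> rat) \<Rightarrow> bool" where
  "padic_null p X \<longleftrightarrow> (\<lambda>n. rat_abs p (X n)) \<longlonglongrightarrow> 0"

definition padic_Cauchy :: "nat \<Rightarrow> (nat \<Rightarrow> rat) \<Rightarrow> bool" where
  "padic_Cauchy p X \<longleftrightarrow> (\<forall>e>0. \<exists>N. \<forall>m\<ge>N. \<forall>n\<ge>N. rat_abs p (X m - X n) < e)"

definition padic_rel :: "nat \<Rightarrow> (nat \<Rightarrow> rat) \<Rightarrow> (nat \<Rightarrow> rat) \<Rightarrow> bool" where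
  "padic_rel p X Y \<longleftrightarrow> padic_Cauchy p X \<and> padic_Cauchy p Y \<and> padic_null p (\<lambda>n. X n - Y n)"

context
  fixes p :: nat
  assumes p: "prime p"
begin

lemma padic_null_0 [simp]: "padic_null p (\<lambda>n. 0)"
  by (simp add: padic_null_def)

lemma padic_null_const [simp]: "padic_null p (\<lambda>n. c) \<longleftrightarrow> c = 0"
  using p by (simp add: padic_null_def LIMSEQ_const_iff)

lemma padic_null_le:
  assumes "padic_null p X" "\<And>n. rat_abs p (Y n) \<le> C * rat_abs p (X n)"
  shows "padic_null p Y"
  unfolding padic_null_def
proof (rule tendsto_sandwich[OF _ _ tendsto_const])
  show "(\<lambda>n. C * rat_abs p (X n)) \<longlonglongrightarrow> 0"
    using assms(1) unfolding padic_null_def by (rule tendsto_mult_right_zero)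
qed (use assms p in auto)

lemma padic_null_minus: "padic_null p X \<Longrightarrow> padic_null p (\<lambda>n. - X n)"
  using p by (simp add: padic_null_def)

lemma padic_null_add:
  assumes "padic_null p X" "padic_null p Y"
  shows "padic_null p (\<lambda>n. X n + Y n)"
  unfolding padic_null_def
proof (rule tendsto_sandwich[OF _ _ tendsto_const])
  show "(\<lambda>n. rat_abs p (X n) + rat_abs p (Y n)) \<longlonglongrightarrow> 0"
    using assms unfolding padic_null_def by (rule tendsto_add_zero)
qed (use assms p rat_abs_triangle in auto)

lemma padic_Cauchy_const [simp]: "padic_Cauchy p (\<lambda>n. c)"
  by (simp add: padic_Cauchy_def)

lemma padic_Cauchy_minus: "padic_Cauchy p X \<Longrightarrow> padic_Cauchy p (\<lambda>n. - X n)"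
  unfolding padic_Cauchy_def using rat_abs_minus_commute[OF p] by simp

lemma padic_Cauchy_add:
  assumes "padic_Cauchy p X" "padic_Cauchy p Y"
  shows "padic_Cauchy p (\<lambda>n. X n + Y n)"
  unfolding padic_Cauchy_def
proof (intro allI impI)
  fix e :: real assume e: "e > 0"
  obtain M where M: "\<And>m n. m \<ge> M \<Longrightarrow> n \<ge> M \<Longrightarrow> rat_abs p (X m - X n) < e"
    using assms(1) e unfolding padic_Cauchy_def by blast
  obtain N where N: "\<And>m n. m \<ge> N \<Longrightarrow> n \<ge> N \<Longrightarrow> rat_abs p (Y m - Y n) < e"
    using assms(2) e unfolding padic_Cauchy_def by blast
  show "\<exists>N. \<forall>m\<ge>N. \<forall>n\<ge>N. rat_abs p (X m + Y m - (X n + Y n)) < e"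
  proof (intro exI[of _ "max M N"] allI impI)
    fix m n assume mn: "m \<ge> max M N" "n \<ge> max M N"
    have "rat_abs p (X m + Y m - (X n + Y n)) \<le> max (rat_abs p (X m - X n)) (rat_abs p (Y m - Y n))"
      using rat_abs_ultra[OF p, of "X m - X n" "Y m - Y n"] by (simp add: algebra_simps)
    also have "\<dots> < e" using M N mn by simp
    finally show "rat_abs p (X m + Y m - (X n + Y n)) < e" .
  qed
qed

lemma padic_Cauchy_abs:
  assumes "padic_Cauchy p X"
  shows "convergent (\<lambda>n. rat_abs p (X n))"
proof (rule Cauchy_convergent, rule metric_CauchyI)
  fix e :: real assume "e > 0"
  then obtain N where N: "\<And>m n. m \<ge> N \<Longrightarrow> n \<ge> N \<Longrightarrow> rat_abs p (X m - X n) < e"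
    using assms unfolding padic_Cauchy_def by blast
  have "dist (rat_abs p (X m)) (rat_abs p (X n)) < e" if "m \<ge> N" "n \<ge> N" for m n
    using N[OF that] rat_abs_triangle'[OF p, of "X m" "X n"] by (simp add: dist_real_def)
  thus "\<exists>M. \<forall>m\<ge>M. \<forall>n\<ge>M. dist (rat_abs p (X m)) (rat_abs p (X n)) < e" by blast
qed

lemma padic_Cauchy_bounded:
  assumes "padic_Cauchy p X"
  obtains B where "B > 0" "\<And>n. rat_abs p (X n) < B"
proof -
  have "Bseq (\<lambda>n. rat_abs p (X n))"
    using padic_Cauchy_abs[OF assms] by (rule convergent_imp_Bseq)
  then obtain K where K: "K > 0" "\<And>n. norm (rat_abs p (X n)) \<le> K" by (elim BseqE) auto
  show thesis
  proof (rule that[of "K + 1"])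
    show "rat_abs p (X n) < K + 1" for n using K(2)[of n] by simp
  qed (use K in auto)
qed

lemma padic_null_mult:
  assumes "padic_null p X" "padic_Cauchy p Y"
  shows "padic_null p (\<lambda>n. X n * Y n)"
proof -
  obtain B where B: "B > 0" "\<And>n. rat_abs p (Y n) < B"
    using padic_Cauchy_bounded[OF assms(2)] by metis
  show ?thesis
  proof (rule padic_null_le[OF assms(1), of _ B])
    fix n
    show "rat_abs p (X n * Y n) \<le> B * rat_abs p (X n)"
      unfolding rat_abs_mult[OF p] mult.commute[of B]
      using B(2)[of n] p by (intro mult_left_mono) auto
  qed
qed

lemma padic_Cauchy_mult:
  assumes "padic_Cauchy p X" "padic_Cauchy p Y"
  shows "padic_Cauchy p (\<lambda>n. X n * Y n)"
  unfolding padic_Cauchy_def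
proof (intro allI impI)
  fix e :: real assume e: "e > 0"
  obtain A where A: "A > 0" "\<And>n. rat_abs p (X n) < A"
    using padic_Cauchy_bounded[OF assms(1)] by metis
  obtain B where B: "B > 0" "\<And>n. rat_abs p (Y n) < B"
    using padic_Cauchy_bounded[OF assms(2)] by metis
  have "e / B > 0" "e / A > 0" using e A B by auto
  then obtain M N where
    M: "\<And>m n. m \<ge> M \<Longrightarrow> n \<ge> M \<Longrightarrow> rat_abs p (X m - X n) < e / B" and
    N: "\<And>m n. m \<ge> N \<Longrightarrow> n \<ge> N \<Longrightarrow> rat_abs p (Y m - Y n) < e / A"
    using assms unfolding padic_Cauchy_def by metis
  show "\<exists>N. \<forall>m\<ge>N. \<forall>n\<ge>N. rat_abs p (X m * Y m - X n * Y n) < e"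
  proof (intro exI[of _ "max M N"] allI impI)
    fix m n assume mn: "m \<ge> max M N" "n \<ge> max M N"
    have "rat_abs p (X m * Y m - X n * Y n) =
        rat_abs p (X m * (Y m - Y n) + (X m - X n) * Y n)"
      by (simp add: algebra_simps)
    also have "\<dots> \<le> max (rat_abs p (X m) * rat_abs p (Y m - Y n))
                        (rat_abs p (X m - X n) * rat_abs p (Y n))"
      using rat_abs_ultra[OF p, of "X m * (Y m - Y n)" "(X m - X n) * Y n"]
      by (simp add: rat_abs_mult[OF p])
    also have "\<dots> < e"
    proof -
      have "rat_abs p (X m) * rat_abs p (Y m - Y n) \<le> A * rat_abs p (Y m - Y n)"
        using A(2)[of m] p by (intro mult_right_mono) auto
      also have "\<dots> < A * (e / A)" using A(1) N mn by (intro mult_strict_left_mono) auto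
      finally have 1: "rat_abs p (X m) * rat_abs p (Y m - Y n) < e" using A(1) by simp
      have "rat_abs p (X m - X n) * rat_abs p (Y n) \<le> rat_abs p (X m - X n) * B"
        using B(2)[of n] p by (intro mult_left_mono) auto
      also have "\<dots> < e / B * B" using B(1) M mn by (intro mult_strict_right_mono) auto
      finally show ?thesis using 1 B(1) by simp
    qed
    finally show "rat_abs p (X m * Y m - X n * Y n) < e" .
  qed
qed

lemma padic_not_null_eventually_const:
  assumes "padic_Cauchy p X" "\<not> padic_null p X"
  obtains c N where "c \<noteq> 0" "\<And>n. n \<ge> N \<Longrightarrow> rat_abs p (X n) = rat_abs p c"
    "\<And>n. n \<ge> N \<Longrightarrow> X n \<noteq> 0"
proof -
  obtain e where e: "e > 0" "\<And>N. \<exists>n\<ge>N. rat_abs p (X n) \<ge> e"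
    using assms(2) p unfolding padic_null_def LIMSEQ_iff by (auto simp: not_less)
  obtain N where N: "\<And>m n. m \<ge> N \<Longrightarrow> n \<ge> N \<Longrightarrow> rat_abs p (X m - X n) < e"
    using assms(1) e(1) unfolding padic_Cauchy_def by blast
  obtain M where M: "M \<ge> N" "rat_abs p (X M) \<ge> e" using e(2) by blast
  have eq: "rat_abs p (X n) = rat_abs p (X M)" if "n \<ge> N" for n
  proof -
    have lt: "rat_abs p (X n - X M) < e" using N M(1) that by blast
    have "rat_abs p (X n) \<le> max (rat_abs p (X n - X M)) (rat_abs p (X M))"
      using rat_abs_ultra[OF p, of "X n - X M" "X M"] by simp
    moreover have "rat_abs p (X M) \<le> max (rat_abs p (X n - X M)) (rat_abs p (X n))"
      using rat_abs_ultra[OF p, of "X M - X n" "X n"] rat_abs_minus_commute[OF p, of "X n" "X M"]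
      by simp
    ultimately show ?thesis using lt M(2) by linarith
  qed
  have "X M \<noteq> 0" using M(2) e(1) by auto
  moreover have "X n \<noteq> 0" if "n \<ge> N" for n
    using eq[OF that] \<open>X M \<noteq> 0\<close> p by auto
  ultimately show thesis using that[of "X M" N] eq by blast
qed

lemma padic_Cauchy_inverse:
  assumes "padic_Cauchy p X" "\<not> padic_null p X"
  shows "padic_Cauchy p (\<lambda>n. inverse (X n))"
  unfolding padic_Cauchy_def
proof (intro allI impI)
  fix e :: real assume e: "e > 0"
  obtain c M where c: "c \<noteq> 0" and M: "\<And>n. n \<ge> M \<Longrightarrow> rat_abs p (X n) = rat_abs p c"
    "\<And>n. n \<ge> M \<Longrightarrow> X n \<noteq> 0"
    using padic_not_null_eventually_const[OF assms] by metis
  let ?C = "rat_abs p c"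
  have C: "?C > 0" using c p by (simp add: less_le)
  have "e * ?C ^ 2 > 0" using e C by simp
  then obtain N where
    N: "\<And>m n. m \<ge> N \<Longrightarrow> n \<ge> N \<Longrightarrow> rat_abs p (X m - X n) < e * ?C ^ 2"
    using assms unfolding padic_Cauchy_def by meson
  show "\<exists>N. \<forall>m\<ge>N. \<forall>n\<ge>N. rat_abs p (inverse (X m) - inverse (X n)) < e"
  proof (intro exI[of _ "max M N"] allI impI)
    fix m n assume mn: "m \<ge> max M N" "n \<ge> max M N"
    have "inverse (X m) - inverse (X n) = inverse (X m) * (X n - X m) * inverse (X n)"
      using M(2) mn by (simp add: field_simps)
    hence "rat_abs p (inverse (X m) - inverse (X n)) = rat_abs p (X n - X m) / ?C ^ 2"
      using M(1) mn
      by (simp add: rat_abs_mult[OF p] rat_abs_inverse[OF p] power2_eq_square divide_inverse mult_ac)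
    also have "\<dots> < e" using N[of n m] mn C by (simp add: field_simps)
    finally show "rat_abs p (inverse (X m) - inverse (X n)) < e" .
  qed
qed

lemma padic_null_diff_commute:
  "padic_null p (\<lambda>n. X n - Y n) \<Longrightarrow> padic_null p (\<lambda>n. Y n - X n)"
  using padic_null_minus[of "\<lambda>n. X n - Y n"] by simp

lemma padic_null_diff_trans:
  "padic_null p (\<lambda>n. X n - Y n) \<Longrightarrow> padic_null p (\<lambda>n. Y n - Z n) \<Longrightarrow> padic_null p (\<lambda>n. X n - Z n)"
  using padic_null_add[of "\<lambda>n. X n - Y n" "\<lambda>n. Y n - Z n"] by simp

lemma padic_null_diff_inverse:
  assumes X: "padic_Cauchy p X" "\<not> padic_null p X"
    and Y: "padic_Cauchy p Y" "\<not> padic_null p Y"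
    and XY: "padic_null p (\<lambda>n. X n - Y n)"
  shows "padic_null p (\<lambda>n. inverse (X n) - inverse (Y n))"
proof -
  have "padic_null p (\<lambda>n. (Y n - X n) * (inverse (X n) * inverse (Y n)))"
    by (intro padic_null_mult padic_null_diff_commute[OF XY]
          padic_Cauchy_mult padic_Cauchy_inverse X Y)
  moreover obtain M where M: "\<And>n. n \<ge> M \<Longrightarrow> X n \<noteq> 0"
    using padic_not_null_eventually_const[OF X] by metis
  moreover obtain N where N: "\<And>n. n \<ge> N \<Longrightarrow> Y n \<noteq> 0"
    using padic_not_null_eventually_const[OF Y] by metis
  have "\<forall>\<^sub>F n in sequentially. rat_abs p ((Y n - X n) * (inverse (X n) * inverse (Y n))) =
          rat_abs p (inverse (X n) - inverse (Y n))"
    using eventually_ge_at_top[of "max M N"]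
  proof eventually_elim
    case (elim n)
    hence "(Y n - X n) * (inverse (X n) * inverse (Y n)) = inverse (X n) - inverse (Y n)"
      using M N by (simp add: field_simps)
    thus ?case by simp
  qed
  ultimately show ?thesis unfolding padic_null_def using tendsto_cong by fast
qed

lemma part_equivp_padic_rel: "part_equivp (padic_rel p)"
proof (rule part_equivpI)
  show "\<exists>X. padic_rel p X X"
    by (rule exI[of _ "\<lambda>_. 0"]) (simp add: padic_rel_def)
  show "symp (padic_rel p)"
    unfolding padic_rel_def by (auto intro!: sympI padic_null_diff_commute)
  show "transp (padic_rel p)"
    unfolding padic_rel_def by (auto intro!: transpI elim: padic_null_diff_trans)
qed

lemma padic_null_imp_Cauchy:
  assumes "padic_null p X" shows "padic_Cauchy p X"
  unfolding padic_Cauchy_def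
proof (intro allI impI)
  fix e :: real assume "e > 0"
  then obtain N where N: "\<And>n. n \<ge> N \<Longrightarrow> rat_abs p (X n) < e"
    using assms p unfolding padic_null_def LIMSEQ_iff by auto
  have "rat_abs p (X m - X n) < e" if "m \<ge> N" "n \<ge> N" for m n
    using rat_abs_ultra[OF p, of "X m" "- X n"] N[OF that(1)] N[OF that(2)] p by simp
  thus "\<exists>N. \<forall>m\<ge>N. \<forall>n\<ge>N. rat_abs p (X m - X n) < e" by blast
qed

end


section \<open>The field of \<open>p\<close>-adic numbers\<close>

text \<open>
  \<open>'p padic\<close> is the completion of the rationals for the \<open>p\<close>-adic absolute value, where
  \<open>p = CARD('p)\<close>. The class \<^class>\<open>prime_card\<close> says that this cardinality is prime; the
  elements of \<open>'p\<close> play no role. The type is introduced by hand because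
  the command for quotient types does not accept a sort constraint on \<open>'p\<close>.
\<close>

typedef ('p::prime_card) padic =
    "{C. \<exists>X. padic_rel CARD('p) X X \<and> C = Collect (padic_rel CARD('p) X)}"
  using part_equivp_padic_rel[OF prime_card[where 'a='p]] unfolding part_equivp_def by blast

definition Padic :: "(nat \<Rightarrow> rat) \<Rightarrow> 'p::prime_card padic" where
  "Padic X = Abs_padic (Collect (padic_rel CARD('p) X))"

definition rep_padic :: "'p::prime_card padic \<Rightarrow> nat \<Rightarrow> rat" where
  "rep_padic x = (SOME X. X \<in> Rep_padic x)"

definition cr_padic :: "(nat \<Rightarrow> rat) \<Rightarrow> 'p::prime_card padic \<Rightarrow> bool" where
  "cr_padic = (\<lambda>X x. padic_rel CARD('p) X X \<and> Padic X = x)"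

lemma Quotient_padic:
  "Quotient (padic_rel CARD('p::prime_card)) Padic rep_padic (cr_padic :: _ \<Rightarrow> 'p padic \<Rightarrow> bool)"
proof -
  interpret quot_type "padic_rel CARD('p)" "Abs_padic :: _ \<Rightarrow> 'p padic" Rep_padic
  proof
    show "part_equivp (padic_rel CARD('p))"
      by (rule part_equivp_padic_rel[OF prime_card])
    show "\<exists>X. padic_rel CARD('p) X X \<and> Rep_padic x = Collect (padic_rel CARD('p) X)"
      for x :: "'p padic"
      using Rep_padic[of x] by simp
    show "Rep_padic (Abs_padic C :: 'p padic) = C"
      if "\<exists>X. padic_rel CARD('p) X X \<and> C = Collect (padic_rel CARD('p) X)" for C
      using that by (intro Abs_padic_inverse) simp
  qed (simp_all add: Rep_padic_inverse Rep_padic_inject)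
  have "abs = Padic" "rep = rep_padic"
    by (auto simp: abs_def rep_def Padic_def rep_padic_def)
  hence "Quotient3 (padic_rel CARD('p)) (Padic :: _ \<Rightarrow> 'p padic) rep_padic"
    using Quotient by simp
  thus ?thesis
    by (rule Quotient3_to_Quotient) (simp add: cr_padic_def)
qed

setup_lifting Quotient_padic

lemma Padic_eq_iff:
  "padic_Cauchy CARD('p) X \<Longrightarrow> padic_Cauchy CARD('p) Y \<Longrightarrow>
     (Padic X = (Padic Y :: 'p::prime_card padic)) \<longleftrightarrow> padic_null CARD('p) (\<lambda>n. X n - Y n)"
  using Quotient_rel[OF Quotient_padic[where 'p='p], of X Y]
    padic_null_0[OF prime_card[where 'a='p]]
  by (auto simp: padic_rel_def)

lemma Padic_cases:
  fixes x :: "'p::prime_card padic"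
  obtains X where "padic_Cauchy CARD('p) X" "x = Padic X"
proof
  show "x = Padic (rep_padic x)"
    using Quotient_abs_rep[OF Quotient_padic] by metis
  show "padic_Cauchy CARD('p) (rep_padic x)"
    using Quotient_rep_reflp[OF Quotient_padic, of x] by (simp add: padic_rel_def)
qed

lemmas padic_prime [simp] = prime_card

instantiation padic :: (prime_card) field
begin

lift_definition zero_padic :: "'a padic" is "\<lambda>n. 0"
  by (simp add: padic_rel_def)

lift_definition one_padic :: "'a padic" is "\<lambda>n. 1"
  by (simp add: padic_rel_def)

lift_definition plus_padic :: "'a padic \<Rightarrow> 'a padic \<Rightarrow> 'a padic" is "\<lambda>X Y n. X n + Y n"
  unfolding padic_rel_def
  using padic_null_add padic_Cauchy_add padic_prime by (force simp: add_diff_add)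

lift_definition uminus_padic :: "'a padic \<Rightarrow> 'a padic" is "\<lambda>X n. - X n"
  unfolding padic_rel_def
  by (auto intro!: padic_Cauchy_minus simp: minus_diff_minus padic_null_diff_commute)

lift_definition times_padic :: "'a padic \<Rightarrow> 'a padic \<Rightarrow> 'a padic" is "\<lambda>X Y n. X n * Y n"
proof -
  fix X X' Y Y' :: "nat \<Rightarrow> rat"
  let ?p = "CARD('a)"
  assume X: "padic_rel ?p X X'" and Y: "padic_rel ?p Y Y'"
  have "padic_null ?p (\<lambda>n. (Y n - Y' n) * X n + (X n - X' n) * Y' n)"
    using X Y unfolding padic_rel_def by (intro padic_null_add padic_null_mult) auto
  thus "padic_rel ?p (\<lambda>n. X n * Y n) (\<lambda>n. X' n * Y' n)"
    using X Y unfolding padic_rel_def by (auto intro!: padic_Cauchy_mult simp: algebra_simps)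
qed

lift_definition inverse_padic :: "'a padic \<Rightarrow> 'a padic"
  is "\<lambda>X. if padic_null CARD('a) X then (\<lambda>n. 0) else (\<lambda>n. inverse (X n))"
proof -
  fix X X' :: "nat \<Rightarrow> rat"
  let ?p = "CARD('a)"
  assume X: "padic_rel ?p X X'"
  hence *: "padic_Cauchy ?p X" "padic_Cauchy ?p X'" "padic_null ?p (\<lambda>n. X n - X' n)"
    by (auto simp: padic_rel_def)
  have "padic_null ?p X \<longleftrightarrow> padic_null ?p X'"
    using padic_null_diff_trans[of ?p X X' "\<lambda>_. 0"] padic_null_diff_trans[of ?p X' X "\<lambda>_. 0"]
      *(3) padic_null_diff_commute[of ?p X X'] by auto
  thus "padic_rel ?p (if padic_null ?p X then \<lambda>n. 0 else (\<lambda>n. inverse (X n)))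
          (if padic_null ?p X' then \<lambda>n. 0 else (\<lambda>n. inverse (X' n)))"
    using * by (auto simp: padic_rel_def intro!: padic_Cauchy_inverse padic_null_diff_inverse)
qed

definition "x - y = x + - y" for x y :: "'a padic"

definition "x div y = x * inverse y" for x y :: "'a padic"

lemma padic_rel_eq:
  "padic_Cauchy CARD('a::prime_card) X \<Longrightarrow> X = Y \<Longrightarrow> padic_rel CARD('a) X Y"
  by (simp add: padic_rel_def)

lemma padic_relD: "padic_rel CARD('a::prime_card) X X \<Longrightarrow> padic_Cauchy CARD('a) X"
  by (simp add: padic_rel_def)

instance
proof
  fix a b c :: "'a padic"
  show "a + b + c = a + (b + c)"
    by transfer (auto simp: algebra_simps intro!: padic_rel_eq padic_Cauchy_add dest!: padic_relD)
  show "a + b = b + a"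
    by transfer (auto simp: algebra_simps intro!: padic_rel_eq padic_Cauchy_add dest!: padic_relD)
  show "0 + a = a" by transfer simp
  show "- a + a = 0" by transfer (simp add: padic_rel_def)
  show "a - b = a + - b" by (rule minus_padic_def)
  show "a * b * c = a * (b * c)"
    by transfer (auto simp: algebra_simps intro!: padic_rel_eq padic_Cauchy_mult dest!: padic_relD)
  show "a * b = b * a"
    by transfer (auto simp: algebra_simps intro!: padic_rel_eq padic_Cauchy_mult dest!: padic_relD)
  show "1 * a = a" by transfer simp
  show "(a + b) * c = a * c + b * c"
    by transfer (auto simp: algebra_simps intro!: padic_rel_eq padic_Cauchy_mult padic_Cauchy_add
          dest!: padic_relD)
  show "(0::'a padic) \<noteq> 1"
    by transfer (simp add: padic_rel_def)
  show "a div b = a * inverse b" by (rule divide_padic_def)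
  show "inverse (0::'a padic) = 0"
    by transfer (simp add: padic_rel_def)
  show "a \<noteq> 0 \<Longrightarrow> inverse a * a = 1"
  proof transfer
    fix X :: "nat \<Rightarrow> rat"
    let ?p = "CARD('a)"
    assume X: "padic_rel ?p X X" "\<not> padic_rel ?p X (\<lambda>n. 0)"
    hence C: "padic_Cauchy ?p X" and nn: "\<not> padic_null ?p X" by (auto simp: padic_rel_def)
    obtain N where N: "\<And>n. n \<ge> N \<Longrightarrow> X n \<noteq> 0"
      using padic_not_null_eventually_const[OF padic_prime C nn] by metis
    have "\<forall>\<^sub>F n in sequentially. rat_abs ?p (inverse (X n) * X n - 1) = 0"
      using eventually_ge_at_top[of N] by eventually_elim (use N in auto)
    hence "padic_null ?p (\<lambda>n. inverse (X n) * X n - 1)"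
      unfolding padic_null_def by (rule tendsto_eventually)
    moreover have "padic_Cauchy ?p (\<lambda>n. inverse (X n) * X n)"
      by (intro padic_Cauchy_mult padic_Cauchy_inverse C nn padic_prime)
    ultimately show "padic_rel ?p
        (\<lambda>n. (if padic_null ?p X then \<lambda>n. 0 else (\<lambda>n. inverse (X n))) n * X n) (\<lambda>n. 1)"
      using nn by (simp add: padic_rel_def)
  qed
qed

end

lemma zero_Padic: "0 = Padic (\<lambda>n. 0)" and one_Padic: "1 = Padic (\<lambda>n. 1)"
  by (simp_all add: zero_padic_def one_padic_def)

lemma Padic_add:
  "padic_Cauchy CARD('p) X \<Longrightarrow> padic_Cauchy CARD('p) Y \<Longrightarrow>
     Padic X + Padic Y = (Padic (\<lambda>n. X n + Y n) :: 'p::prime_card padic)"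
  by (subst plus_padic.abs_eq) (simp_all add: padic_rel_def)

lemma Padic_minus:
  "padic_Cauchy CARD('p) X \<Longrightarrow> - Padic X = (Padic (\<lambda>n. - X n) :: 'p::prime_card padic)"
  by (subst uminus_padic.abs_eq) (simp_all add: padic_rel_def)

lemma Padic_mult:
  "padic_Cauchy CARD('p) X \<Longrightarrow> padic_Cauchy CARD('p) Y \<Longrightarrow>
     Padic X * Padic Y = (Padic (\<lambda>n. X n * Y n) :: 'p::prime_card padic)"
  by (subst times_padic.abs_eq) (simp_all add: padic_rel_def)

lemma Padic_const_eq_iff [simp]:
  "(Padic (\<lambda>_. c) = (Padic (\<lambda>_. d) :: 'p::prime_card padic)) \<longleftrightarrow> c = d"
  by (simp add: Padic_eq_iff)

lemma of_nat_padic: "of_nat k = (Padic (\<lambda>n. of_nat k) :: 'p::prime_card padic)"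
  by (induction k) (simp_all add: zero_Padic one_Padic Padic_add)

instance padic :: (prime_card) field_char_0
proof
  show "inj (of_nat :: nat \<Rightarrow> 'a padic)"
    by (rule injI) (simp add: of_nat_padic)
qed

lemma of_int_padic: "of_int k = (Padic (\<lambda>n. of_int k) :: 'p::prime_card padic)"
  by (cases k rule: int_diff_cases)
     (simp add: of_nat_padic Padic_minus Padic_add flip: add_uminus_conv_diff)

lemma of_rat_padic: "of_rat c = (Padic (\<lambda>n. c) :: 'p::prime_card padic)"
proof -
  obtain a b where ab: "quotient_of c = (a, b)" by (cases "quotient_of c")
  have c: "c = of_int a / of_int b" and b: "b \<noteq> 0"
    using quotient_of_div[OF ab] quotient_of_denom_pos[OF ab] by auto
  have "Padic (\<lambda>n. c) * of_int b = (of_int a :: 'p padic)"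
    using b by (simp add: of_int_padic Padic_mult c)
  moreover have "of_rat c * of_int b = (of_int a :: 'p padic)"
    using b by (simp add: c of_rat_divide)
  ultimately have "Padic (\<lambda>n. c) * of_int b = (of_rat c * of_int b :: 'p padic)" by simp
  thus ?thesis using b by simp
qed

lift_definition padic_norm :: "'a::prime_card padic \<Rightarrow> real"
  is "\<lambda>X. lim (\<lambda>n. rat_abs CARD('a) (X n))"
proof -
  fix X Y :: "nat \<Rightarrow> rat"
  let ?a = "rat_abs CARD('a)"
  assume XY: "padic_rel CARD('a) X Y"
  have "(\<lambda>n. ?a (Y n)) \<longlonglongrightarrow> lim (\<lambda>n. ?a (Y n))"
    using XY padic_Cauchy_abs[OF padic_prime[where 'a='a], of Y] unfolding padic_rel_def
    by (simp add: convergent_LIMSEQ_iff)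
  moreover have "(\<lambda>n. ?a (X n) - ?a (Y n)) \<longlonglongrightarrow> 0"
  proof (rule tendsto_0_le[where K = 1])
    show "(\<lambda>n. ?a (X n - Y n)) \<longlonglongrightarrow> 0"
      using XY by (simp add: padic_rel_def padic_null_def)
    show "\<forall>\<^sub>F n in sequentially. norm (?a (X n) - ?a (Y n)) \<le> norm (?a (X n - Y n)) * 1"
      using rat_abs_triangle'[OF padic_prime[where 'a='a]] by simp
  qed
  ultimately have "(\<lambda>n. (?a (X n) - ?a (Y n)) + ?a (Y n)) \<longlonglongrightarrow> 0 + lim (\<lambda>n. ?a (Y n))"
    by (intro tendsto_add)
  thus "lim (\<lambda>n. ?a (X n)) = lim (\<lambda>n. ?a (Y n))"
    by (intro limI) simp
qed

lemma norm_Padic: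
  assumes "padic_Cauchy CARD('p) X"
  shows "(\<lambda>n. rat_abs CARD('p) (X n)) \<longlonglongrightarrow> padic_norm (Padic X :: 'p::prime_card padic)"
proof -
  have "padic_norm (Padic X :: 'p padic) = lim (\<lambda>n. rat_abs CARD('p) (X n))"
    using assms by (subst padic_norm.abs_eq) (simp_all add: padic_rel_def)
  thus ?thesis
    using padic_Cauchy_abs[OF padic_prime assms] by (simp add: convergent_LIMSEQ_iff)
qed

lemma norm_Padic_eqI:
  "padic_Cauchy CARD('p) X \<Longrightarrow> (\<lambda>n. rat_abs CARD('p) (X n)) \<longlonglongrightarrow> c \<Longrightarrow>
     padic_norm (Padic X :: 'p::prime_card padic) = c"
  using norm_Padic LIMSEQ_unique by blast

lemma norm_padic_of_rat [simp]: "padic_norm (of_rat c :: 'p::prime_card padic) = rat_abs CARD('p) c"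
  unfolding of_rat_padic by (rule norm_Padic_eqI) simp_all

lemma norm_padic_nonneg [simp]: "padic_norm (x :: 'p::prime_card padic) \<ge> 0"
proof (cases x rule: Padic_cases)
  case (1 X)
  show ?thesis unfolding 1(2)
    by (rule LIMSEQ_le_const[OF norm_Padic[OF 1(1)]]) simp
qed

lemma norm_padic_eq_0_iff [simp]: "padic_norm (x :: 'p::prime_card padic) = 0 \<longleftrightarrow> x = 0"
proof (cases x rule: Padic_cases)
  case (1 X)
  have "x = 0 \<longleftrightarrow> padic_null CARD('p) X"
    using 1 by (simp add: zero_Padic Padic_eq_iff)
  also have "\<dots> \<longleftrightarrow> padic_norm x = 0"
    unfolding padic_null_def 1(2) using norm_Padic[OF 1(1)] LIMSEQ_unique by metis
  finally show ?thesis by simp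
qed

lemma padic_norm_0 [simp]: "padic_norm (0 :: 'p::prime_card padic) = 0"
  using norm_padic_eq_0_iff by blast

lemma norm_padic_minus [simp]: "padic_norm (- x :: 'p::prime_card padic) = padic_norm x"
proof (cases x rule: Padic_cases)
  case (1 X)
  show ?thesis unfolding 1(2) Padic_minus[OF 1(1)]
    by (rule norm_Padic_eqI) (use 1 norm_Padic padic_Cauchy_minus in auto)
qed

lemma norm_padic_mult: "padic_norm (x * y :: 'p::prime_card padic) = padic_norm x * padic_norm y"
proof (cases x rule: Padic_cases)
  case X: (1 X)
  show ?thesis
  proof (cases y rule: Padic_cases)
    case Y: (1 Y)
    show ?thesis unfolding X(2) Y(2) Padic_mult[OF X(1) Y(1)]
      by (rule norm_Padic_eqI)
         (auto intro!: padic_Cauchy_mult tendsto_mult norm_Padic X Y simp: rat_abs_mult)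
  qed
qed

lemma norm_padic_ultra: "padic_norm (x + y :: 'p::prime_card padic) \<le> max (padic_norm x) (padic_norm y)"
proof (cases x rule: Padic_cases)
  case X: (1 X)
  show ?thesis
  proof (cases y rule: Padic_cases)
    case Y: (1 Y)
    show ?thesis unfolding X(2) Y(2) Padic_add[OF X(1) Y(1)]
    proof (rule LIMSEQ_le)
      show "(\<lambda>n. rat_abs CARD('p) (X n + Y n)) \<longlonglongrightarrow> padic_norm (Padic (\<lambda>n. X n + Y n) :: 'p padic)"
        by (intro norm_Padic padic_Cauchy_add X Y padic_prime)
      show "(\<lambda>n. max (rat_abs CARD('p) (X n)) (rat_abs CARD('p) (Y n))) \<longlonglongrightarrow>
              max (padic_norm (Padic X :: 'p padic)) (padic_norm (Padic Y :: 'p padic))"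
        by (intro tendsto_max norm_Padic X Y)
    qed (use rat_abs_ultra[OF padic_prime] in blast)
  qed
qed

instantiation padic :: (prime_card) metric_space
begin

definition dist_padic :: "'a padic \<Rightarrow> 'a padic \<Rightarrow> real" where
  "dist_padic x y = padic_norm (x - y)"

definition uniformity_padic :: "('a padic \<times> 'a padic) filter" where
  "uniformity_padic = (INF e\<in>{0<..}. principal {(x, y). dist x y < e})"

definition open_padic :: "'a padic set \<Rightarrow> bool" where
  "open_padic U \<longleftrightarrow> (\<forall>x\<in>U. eventually (\<lambda>(x', y). x' = x \<longrightarrow> y \<in> U) uniformity)"

instance
proof
  fix x y z :: "'a padic"
  show "dist x y = 0 \<longleftrightarrow> x = y" by (simp add: dist_padic_def)
  have "padic_norm (x - z + (z - y)) \<le> max (padic_norm (x - z)) (padic_norm (z - y))" by (rule norm_padic_ultra)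
  moreover have "padic_norm (z - y) = padic_norm (y - z)" using norm_padic_minus[of "z - y"] by simp
  ultimately show "dist x y \<le> dist x z + dist y z"
    using norm_padic_nonneg[of "x - z"] norm_padic_nonneg[of "y - z"]
    by (simp add: dist_padic_def del: norm_padic_nonneg)
qed (simp_all add: uniformity_padic_def open_padic_def)

end

lemma norm_padic_nonzero:
  fixes x :: "'p::prime_card padic"
  assumes "x \<noteq> 0"
  shows "\<exists>!k. padic_norm x = real CARD('p) powi (- k)"
proof (cases x rule: Padic_cases)
  case (1 X)
  have nn: "\<not> padic_null CARD('p) X" using assms 1 by (simp add: zero_Padic Padic_eq_iff)
  obtain c N where c: "c \<noteq> 0" "\<And>n. n \<ge> N \<Longrightarrow> rat_abs CARD('p) (X n) = rat_abs CARD('p) c"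
    using padic_not_null_eventually_const[OF padic_prime 1(1) nn] by metis
  have "padic_norm x = rat_abs CARD('p) c" unfolding 1(2)
  proof (rule norm_Padic_eqI[OF 1(1)], rule tendsto_eventually)
    show "\<forall>\<^sub>F n in sequentially. rat_abs CARD('p) (X n) = rat_abs CARD('p) c"
      using eventually_ge_at_top[of N] by eventually_elim (rule c)
  qed
  hence "padic_norm x = real CARD('p) powi (- rat_val CARD('p) c)"
    using c(1) by (simp add: rat_abs_def)
  moreover have "k = l" if "real CARD('p) powi (- k) = real CARD('p) powi (- l)" for k l
    using that p_gt_1[OF padic_prime[where 'a='p]] power_int_strict_increasing[of _ _ "real CARD('p)"]
    by (metis linorder_neqE neg_less_iff_less less_irrefl)
  ultimately show ?thesis by metis
qed

definition padic_val :: "'p::prime_card padic \<Rightarrow> int extended" where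
  "padic_val x = (if x = 0 then Pinf else Fin (THE k. padic_norm x = real CARD('p) powi (- k)))"

lemma padic_val_of_rat: "c \<noteq> 0 \<Longrightarrow> padic_val (of_rat c :: 'p::prime_card padic) = Fin (rat_val CARD('p) c)"
  using norm_padic_nonzero[of "of_rat c :: 'p padic"]
  by (auto simp: padic_val_def rat_abs_def intro!: the1_equality)


section \<open>Balanced digit expansions\<close>

text \<open>For odd \<open>p\<close> the expansion exists and is unique: \<open>ex1_balanced_expansion\<close> below.\<close>

definition balanced_digits :: "nat \<Rightarrow> int set" where
  "balanced_digits p = {- ((int p - 1) div 2) .. (int p - 1) div 2}"

definition is_balanced_expansion :: "(int \<Rightarrow> int) \<Rightarrow> 'p::prime_card padic \<Rightarrow> bool" where
  "is_balanced_expansion a x \<longleftrightarrow>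
     (\<forall>n. a n \<in> balanced_digits CARD('p)) \<and>
     (\<exists>r::int. (\<forall>n < - r. a n = 0) \<and>
        (\<lambda>k. of_int (a (int k - r)) * of_nat CARD('p) powi (int k - r)) sums x)"

lemma rat_abs_of_int:
  assumes "prime p"
  shows "rat_abs p (of_int k) \<le> 1" "rat_abs p (of_int k) < 1 \<longleftrightarrow> int p dvd k"
proof -
  have "real p powi (- int (multiplicity (int p) k)) \<le> real p powi 0"
    using p_gt_1[OF assms] by (intro power_int_increasing) auto
  thus "rat_abs p (of_int k) \<le> 1"
    using rat_val_of_int[OF assms, of k] by (simp add: rat_abs_def)
  show "rat_abs p (of_int k) < 1 \<longleftrightarrow> int p dvd k"
  proof (cases "k = 0")
    case False
    have "rat_abs p (of_int k) = real p powi (- int (multiplicity (int p) k))"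
      using False rat_val_of_int[OF assms, of k] by (simp add: rat_abs_def)
    also have "\<dots> < 1 \<longleftrightarrow> multiplicity (int p) k > 0"
      using p_gt_1[OF assms] power_int_strict_increasing[of "- int (multiplicity (int p) k)" 0 "real p"]
      by (cases "multiplicity (int p) k = 0") auto
    also have "\<dots> \<longleftrightarrow> int p dvd k"
      using False assms by (intro multiplicity_gt_zero_iff) auto
    finally show ?thesis .
  qed simp
qed

lemma padic_norm_of_int_less_1:
  "padic_norm (of_int k :: 'p::prime_card padic) < 1 \<longleftrightarrow> int CARD('p) dvd k"
  using rat_abs_of_int(2)[OF padic_prime, of k] norm_padic_of_rat[of "of_int k", where 'p='p]
  by simp

lemma padic_norm_of_int_le_1: "padic_norm (of_int k :: 'p::prime_card padic) \<le> 1"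
  using rat_abs_of_int(1)[OF padic_prime, of k] norm_padic_of_rat[of "of_int k", where 'p='p]
  by simp

lemma padic_norm_p_powi:
  "padic_norm (of_nat CARD('p) powi n :: 'p::prime_card padic) = real CARD('p) powi (- n)"
proof -
  have p: "prime CARD('p)" by simp
  have v: "rat_val CARD('p) (of_nat (CARD('p) ^ k)) = int k" for k
  proof -
    have "rat_val CARD('p) (of_int (int CARD('p) ^ k)) = int k"
      using p by (subst rat_val_of_int[OF p]) auto
    thus ?thesis by simp
  qed
  have nat: "padic_norm (of_nat CARD('p) ^ k :: 'p padic) = real CARD('p) powi (- int k)" for k
  proof -
    have "(of_nat CARD('p) ^ k :: 'p padic) = of_rat (of_nat (CARD('p) ^ k))"
      by (simp add: of_rat_power)
    also have "padic_norm \<dots> = rat_abs CARD('p) (of_nat (CARD('p) ^ k))"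
      by (rule norm_padic_of_rat)
    also have "\<dots> = real CARD('p) powi (- int k)"
      using v[of k] by (simp add: rat_abs_def)
    finally show ?thesis .
  qed
  have inv: "padic_norm (inverse x) = inverse (padic_norm x)" for x :: "'p padic"
  proof (cases "x = 0")
    case False
    hence "padic_norm x * padic_norm (inverse x) = padic_norm (1 :: 'p padic)"
      by (simp flip: norm_padic_mult)
    also have "padic_norm (1 :: 'p padic) = 1"
      using norm_padic_of_rat[of 1, where 'p='p] by simp
    finally show ?thesis using False by (simp add: field_simps)
  next
    case True
    thus ?thesis using norm_padic_eq_0_iff[of "0 :: 'p padic"] by simp
  qed
  show ?thesis
  proof (cases "n \<ge> 0")
    case True
    thus ?thesis using nat[of "nat n"] by (simp add: power_int_def)
  next
    case False
    hence "of_nat CARD('p) powi n = inverse (of_nat CARD('p) ^ nat (- n) :: 'p padic)"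
      by (simp add: power_int_def power_inverse)
    thus ?thesis using False nat[of "nat (- n)"]
      by (simp only: inv) (simp add: power_int_minus power_int_def power_inverse)
  qed
qed

lemma padic_norm_less_powiD:
  fixes x :: "'p::prime_card padic"
  assumes "padic_norm x < real CARD('p) powi n"
  shows "padic_norm x \<le> real CARD('p) powi (n - 1)"
proof (cases "x = 0")
  case True
  hence "padic_norm x = 0" by simp
  thus ?thesis by simp
next
  case False
  then obtain k where k: "padic_norm x = real CARD('p) powi (- k)"
    using norm_padic_nonzero by blast
  have p1: "real CARD('p) > 1" by (rule p_gt_1[OF padic_prime])
  have "- k < n"
  proof (rule ccontr)
    assume "\<not> - k < n"
    hence "real CARD('p) powi n \<le> real CARD('p) powi (- k)"
      using p1 by (intro power_int_increasing) auto
    thus False using assms k by simp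
  qed
  thus ?thesis unfolding k using p1 by (intro power_int_increasing) auto
qed

lemma padic_rat_dense:
  fixes x :: "'p::prime_card padic"
  assumes "e > 0"
  obtains c where "padic_norm (x - of_rat c) < e"
proof (cases x rule: Padic_cases)
  case (1 X)
  have "e / 2 > 0" using assms by simp
  then obtain N where
    N: "\<And>m n. m \<ge> N \<Longrightarrow> n \<ge> N \<Longrightarrow> rat_abs CARD('p) (X m - X n) < e / 2"
    using 1(1) unfolding padic_Cauchy_def by blast
  have C: "padic_Cauchy CARD('p) (\<lambda>n. X n + - X N)"
    by (intro padic_Cauchy_add 1 padic_prime padic_Cauchy_const)
  have "x - of_rat (X N) = Padic (\<lambda>n. X n + - X N)"
    unfolding 1(2) of_rat_padic diff_conv_add_uminus
    using 1(1) by (simp add: Padic_minus Padic_add del: add_uminus_conv_diff)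
  moreover have "padic_norm (Padic (\<lambda>n. X n + - X N) :: 'p padic) \<le> e / 2"
    by (rule LIMSEQ_le_const2[OF norm_Padic[OF C]]) (use N in \<open>auto intro!: exI[of _ N] less_imp_le\<close>)
  ultimately show thesis using that[of "X N"] assms by simp
qed

lemma ex_balanced_digit:
  fixes x :: "'p::prime_card padic"
  assumes "odd CARD('p)" "padic_norm x \<le> 1"
  shows "\<exists>d\<in>balanced_digits CARD('p). padic_norm (x - of_int d) < 1"
proof -
  let ?p = "CARD('p)"
  have p: "prime ?p" by simp
  have p1: "real ?p > 1" by (rule p_gt_1[OF p])
  obtain c where c: "padic_norm (x - of_rat c) < 1"
    using padic_rat_dense[of 1 x] by auto
  have "padic_norm (of_rat c :: 'p padic) \<le> max (padic_norm (of_rat c - x)) (padic_norm x)"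
    using norm_padic_ultra[of "of_rat c - x" x] by simp
  also have "padic_norm (of_rat c - x) = padic_norm (x - of_rat c)"
    using norm_padic_minus[of "x - of_rat c"] by simp
  finally have c1: "rat_abs ?p c \<le> 1" using c assms(2) by simp
  obtain a b where ab: "quotient_of c = (a, b)" by (cases "quotient_of c")
  have c_eq: "c = of_int a / of_int b" and b: "b > 0" and cop: "coprime a b"
    using quotient_of_div[OF ab] quotient_of_denom_pos[OF ab] quotient_of_coprime[OF ab] by auto
  have nb: "\<not> int ?p dvd b"
  proof
    assume dvd: "int ?p dvd b"
    hence na: "\<not> int ?p dvd a"
      using coprime_common_divisor[OF cop _ dvd] p1 by auto
    have "rat_abs ?p (of_int a) = rat_abs ?p c * rat_abs ?p (of_int b)"
      using b by (simp add: c_eq flip: rat_abs_mult[OF p])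
    also have "\<dots> \<le> 1 * rat_abs ?p (of_int b)"
      using c1 p by (intro mult_right_mono) auto
    also have "\<dots> < 1" using rat_abs_of_int(2)[OF p, of b] dvd by simp
    finally show False using rat_abs_of_int(2)[OF p, of a] na by simp
  qed
  hence "coprime b (int ?p)"
    using p by (metis coprime_commute prime_imp_coprime prime_nat_int_transfer)
  then obtain y where y: "[b * y = 1] (mod int ?p)" using cong_solve_coprime_int by blast
  define h where "h = (int ?p - 1) div 2"
  have h: "int ?p = 2 * h + 1" using assms(1) unfolding h_def by presburger
  define d where "d = (a * y + h) mod int ?p - h"
  have d: "d \<in> balanced_digits ?p"
    using pos_mod_bound[of "int ?p" "a * y + h"] pos_mod_sign[of "int ?p" "a * y + h"] p1 h
    unfolding balanced_digits_def h_def[symmetric] d_def by auto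
  have "[d = a * y] (mod int ?p)"
    unfolding d_def by (simp add: cong_def mod_diff_left_eq)
  hence "[b * d = b * (a * y)] (mod int ?p)" by (rule cong_scalar_left)
  also have "b * (a * y) = a * (b * y)" by simp
  also have "[a * (b * y) = a * 1] (mod int ?p)" using y by (rule cong_scalar_left)
  finally have "[a = b * d] (mod int ?p)" by (simp add: cong_sym)
  hence dvd: "int ?p dvd a - b * d" by (simp add: cong_iff_dvd_diff)
  have "(c - of_int d) * of_int b = of_int (a - b * d)"
    using b by (simp add: c_eq field_simps)
  hence "rat_abs ?p (c - of_int d) * rat_abs ?p (of_int b) = rat_abs ?p (of_int (a - b * d))"
    using rat_abs_mult[OF p] by metis
  moreover have "rat_abs ?p (of_int b) = 1"
    using rat_abs_of_int[OF p, of b] nb by linarith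
  moreover have "rat_abs ?p (of_int (a - b * d)) < 1"
    using rat_abs_of_int(2)[OF p] dvd by blast
  ultimately have "rat_abs ?p (c - of_int d) < 1" by simp
  hence "padic_norm (of_rat (c - of_int d) :: 'p padic) < 1" by simp
  moreover have "x - of_int d = (x - of_rat c) + of_rat (c - of_int d)"
    by (simp add: of_rat_diff)
  ultimately have "padic_norm (x - of_int d) < 1"
    using c norm_padic_ultra[of "x - of_rat c" "of_rat (c - of_int d)"]
    by (metis max_less_iff_conj order_le_less_trans)
  thus ?thesis using d by blast
qed

lemma ex_balanced_digit_powi:
  fixes x :: "'p::prime_card padic"
  assumes "odd CARD('p)" "padic_norm x \<le> real CARD('p) powi (- n)"
  shows "\<exists>d\<in>balanced_digits CARD('p).
           padic_norm (x - of_int d * of_nat CARD('p) powi n) \<le> real CARD('p) powi (- (n + 1))"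
proof -
  let ?P = "of_nat CARD('p) powi n :: 'p padic"
  have p1: "real CARD('p) > 1" by (rule p_gt_1[OF padic_prime])
  have P: "?P \<noteq> 0" by simp
  have NP: "padic_norm ?P = real CARD('p) powi (- n)" by (rule padic_norm_p_powi)
  have pos: "real CARD('p) powi (- n) > 0" using p1 by simp
  have "padic_norm (x / ?P) * padic_norm ?P = padic_norm x"
    using P by (simp flip: norm_padic_mult)
  hence "padic_norm (x / ?P) * real CARD('p) powi (- n) \<le> 1 * real CARD('p) powi (- n)"
    using assms(2) NP by simp
  hence "padic_norm (x / ?P) \<le> 1" using pos by (rule mult_right_le_imp_le)
  then obtain d where d: "d \<in> balanced_digits CARD('p)" "padic_norm (x / ?P - of_int d) < 1"
    using ex_balanced_digit[OF assms(1)] by blast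
  have "padic_norm (x - of_int d * ?P) = padic_norm (x / ?P - of_int d) * padic_norm ?P"
    using P by (simp add: left_diff_distrib flip: norm_padic_mult)
  also have "\<dots> < 1 * real CARD('p) powi (- n)"
    unfolding NP using d(2) pos by (rule mult_strict_right_mono)
  finally have "padic_norm (x - of_int d * ?P) \<le> real CARD('p) powi (- n - 1)"
    by (intro padic_norm_less_powiD) simp
  thus ?thesis using d(1) by (auto intro!: bexI[of _ d])
qed

lemma padic_sums_tail:
  fixes f :: "nat \<Rightarrow> 'p::prime_card padic"
  assumes "f sums x" "\<And>k. k \<ge> K \<Longrightarrow> padic_norm (f k) \<le> B" "B > 0"
  shows "padic_norm (x - (\<Sum>k<K. f k)) \<le> B"
proof -
  have B: "padic_norm ((\<Sum>k<K + m. f k) - (\<Sum>k<K. f k)) \<le> B" for m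
  proof (induction m)
    case 0
    have "padic_norm (0 :: 'p padic) = 0" by simp
    thus ?case using assms(3) by simp
  next
    case (Suc m)
    have "padic_norm ((\<Sum>k<K + Suc m. f k) - (\<Sum>k<K. f k)) \<le>
            max (padic_norm ((\<Sum>k<K + m. f k) - (\<Sum>k<K. f k))) (padic_norm (f (K + m)))"
      using norm_padic_ultra[of "(\<Sum>k<K + m. f k) - (\<Sum>k<K. f k)" "f (K + m)"]
      by (simp add: algebra_simps)
    thus ?case using Suc assms(2)[of "K + m"] by simp
  qed
  obtain M where M: "\<And>n. n \<ge> M \<Longrightarrow> dist (\<Sum>k<n. f k) x < B"
    using assms(1,3) unfolding sums_def lim_sequentially by blast
  have "padic_norm ((\<Sum>k<K + M. f k) - x) < B"
    using M[of "K + M"] by (simp add: dist_padic_def)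
  hence "padic_norm (x - (\<Sum>k<K + M. f k)) < B"
    using norm_padic_minus[of "x - (\<Sum>k<K + M. f k)"] by simp
  thus ?thesis
    using B[of M] norm_padic_ultra[of "x - (\<Sum>k<K + M. f k)" "(\<Sum>k<K + M. f k) - (\<Sum>k<K. f k)"]
    by simp
qed

lemma is_balanced_expansion_approx:
  fixes x :: "'p::prime_card padic"
  assumes "is_balanced_expansion a x"
  obtains r where "\<And>n. n < - r \<Longrightarrow> a n = 0"
    "\<And>R N. R \<ge> r \<Longrightarrow>
       padic_norm (x - (\<Sum>n=-R..<N. of_int (a n) * of_nat CARD('p) powi n))
         \<le> real CARD('p) powi (- N)"
proof -
  let ?g = "\<lambda>n. of_int (a n) * of_nat CARD('p) powi n :: 'p padic"
  have p1: "real CARD('p) > 1" by (rule p_gt_1[OF padic_prime])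
  obtain r where r: "\<And>n. n < - r \<Longrightarrow> a n = 0" "(\<lambda>k. ?g (int k - r)) sums x"
    using assms unfolding is_balanced_expansion_def by blast
  have *: "padic_norm (x - (\<Sum>n=-R..<N. ?g n)) \<le> real CARD('p) powi (- N)"
    if "R \<ge> r" "N \<ge> - r" for R N
  proof -
    have "padic_norm (x - (\<Sum>k<nat (N + r). ?g (int k - r))) \<le> real CARD('p) powi (- N)"
    proof (rule padic_sums_tail[OF r(2)])
      fix k assume k: "k \<ge> nat (N + r)"
      have "padic_norm (?g (int k - r)) \<le> 1 * real CARD('p) powi (- (int k - r))"
        unfolding norm_padic_mult padic_norm_p_powi
        by (intro mult_right_mono padic_norm_of_int_le_1) auto
      also have "\<dots> \<le> real CARD('p) powi (- N)"
        unfolding mult_1 using k p1 by (intro power_int_increasing) auto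
      finally show "padic_norm (?g (int k - r)) \<le> real CARD('p) powi (- N)" .
    qed (use p1 in auto)
    also have "(\<Sum>k<nat (N + r). ?g (int k - r)) = (\<Sum>n=-r..<N. ?g n)"
      by (rule sum.reindex_bij_witness[of _ "\<lambda>n. nat (n + r)" "\<lambda>k. int k - r"]) auto
    also have "\<dots> = (\<Sum>n=-R..<N. ?g n)"
      using that by (intro sum.mono_neutral_left) (auto simp: r(1))
    finally show ?thesis .
  qed
  have "padic_norm (x - (\<Sum>n=-R..<N. ?g n)) \<le> real CARD('p) powi (- N)" if "R \<ge> r" for R N
  proof (cases "N \<ge> - r")
    case False
    have "(\<Sum>n=-R..<N. ?g n) = 0" using False by (intro sum.neutral) (auto simp: r(1))
    moreover have "padic_norm x \<le> real CARD('p) powi r" using *[of r "- r"] by simp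
    moreover have "real CARD('p) powi r \<le> real CARD('p) powi (- N)"
      using False p1 by (intro power_int_increasing) auto
    ultimately show ?thesis by simp
  qed (use * that in blast)
  thus thesis using that[of r] r(1) by blast
qed

lemma is_balanced_expansion_unique:
  fixes x :: "'p::prime_card padic"
  assumes "is_balanced_expansion a x" "is_balanced_expansion b x"
  shows "a = b"
proof (rule ccontr)
  assume ne: "a \<noteq> b"
  have p: "prime CARD('p)" by simp
  have p1: "real CARD('p) > 1" by (rule p_gt_1[OF padic_prime])
  obtain r where r: "\<And>n. n < - r \<Longrightarrow> a n = 0"
    "\<And>R N. R \<ge> r \<Longrightarrow>
       padic_norm (x - (\<Sum>n=-R..<N. of_int (a n) * of_nat CARD('p) powi n))
         \<le> real CARD('p) powi (- N)"
    using is_balanced_expansion_approx[OF assms(1)] by metis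
  obtain s where s: "\<And>n. n < - s \<Longrightarrow> b n = 0"
    "\<And>R N. R \<ge> s \<Longrightarrow>
       padic_norm (x - (\<Sum>n=-R..<N. of_int (b n) * of_nat CARD('p) powi n))
         \<le> real CARD('p) powi (- N)"
    using is_balanced_expansion_approx[OF assms(2)] by metis
  define R where "R = max r s"
  define j where "j = (LEAST k. a (int k - R) \<noteq> b (int k - R))"
  define N where "N = int j - R"
  obtain m where m: "a m \<noteq> b m" using ne by blast
  have "m \<ge> - R"
  proof (rule ccontr)
    assume "\<not> m \<ge> - R"
    hence "m < - r" "m < - s" by (auto simp: R_def)
    thus False using m r(1) s(1) by simp
  qed
  hence ex: "a (int (nat (m + R)) - R) \<noteq> b (int (nat (m + R)) - R)" using m by simp
  have abN: "a N \<noteq> b N"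
    unfolding N_def j_def by (rule LeastI[where P = "\<lambda>k. a (int k - R) \<noteq> b (int k - R)", OF ex])
  have eq: "a n = b n" if "- R \<le> n" "n < N" for n
  proof -
    have "nat (n + R) < j" using that by (simp add: N_def)
    from not_less_Least[OF this[unfolded j_def]] show ?thesis using that by simp
  qed
  let ?S = "\<lambda>c. (\<Sum>n=-R..<N + 1. of_int (c n) * of_nat CARD('p) powi n) :: 'p padic"
  let ?T = "\<lambda>c. (\<Sum>n=-R..<N. of_int (c n) * of_nat CARD('p) powi n) :: 'p padic"
  have split: "?S c = of_int (c N) * of_nat CARD('p) powi N + ?T c" for c
  proof -
    have "{-R..<N + 1} = insert N {-R..<N}" by (auto simp: N_def)
    thus ?thesis by simp
  qed
  have "?T a = ?T b" by (intro sum.cong) (auto simp: eq)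
  hence "?S a - ?S b = of_int (a N - b N) * of_nat CARD('p) powi N"
    unfolding split by (simp add: algebra_simps)
  hence 1: "padic_norm (?S a - ?S b) =
      padic_norm (of_int (a N - b N) :: 'p padic) * real CARD('p) powi (- N)"
    by (simp only: norm_padic_mult padic_norm_p_powi)
  have "\<bar>a N - b N\<bar> < int CARD('p)"
  proof -
    have "a N \<in> balanced_digits CARD('p)" "b N \<in> balanced_digits CARD('p)"
      using assms unfolding is_balanced_expansion_def by blast+
    thus ?thesis using p1 by (auto simp: balanced_digits_def)
  qed
  hence "\<not> int CARD('p) dvd a N - b N" using abN dvd_imp_le_int[of "a N - b N" "int CARD('p)"] by auto
  hence "padic_norm (of_int (a N - b N) :: 'p padic) = 1"
    using padic_norm_of_int_less_1[of "a N - b N", where 'p='p]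
      padic_norm_of_int_le_1[of "a N - b N", where 'p='p] by linarith
  with 1 have 2: "padic_norm (?S a - ?S b) = real CARD('p) powi (- N)" by simp
  have "padic_norm (x - ?S a) \<le> real CARD('p) powi (- (N + 1))"
    "padic_norm (x - ?S b) \<le> real CARD('p) powi (- (N + 1))"
    by (intro r(2) s(2); simp add: R_def N_def)+
  moreover have "padic_norm (?S a - ?S b) \<le> max (padic_norm (x - ?S b)) (padic_norm (x - ?S a))"
    using norm_padic_ultra[of "x - ?S b" "- (x - ?S a)"] norm_padic_minus[of "x - ?S a"] by simp
  ultimately have "padic_norm (?S a - ?S b) \<le> real CARD('p) powi (- (N + 1))" by linarith
  also have "\<dots> < real CARD('p) powi (- N)"
    using p1 by (intro power_int_strict_increasing) auto
  finally show False using 2 by simp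
qed

lemma ex_balanced_expansion:
  fixes x :: "'p::prime_card padic"
  assumes "odd CARD('p)"
  shows "\<exists>a. is_balanced_expansion a x"
proof -
  let ?p = "CARD('p)"
  let ?P = "\<lambda>n. of_nat ?p powi n :: 'p padic"
  have p1: "real ?p > 1" by (rule p_gt_1[OF padic_prime])
  obtain r where r: "padic_norm x \<le> real ?p powi r"
  proof (cases "x = 0")
    case True
    thus ?thesis using that[of 0] norm_padic_eq_0_iff[of x] by simp
  next
    case False
    then obtain k where "padic_norm x = real ?p powi (- k)" using norm_padic_nonzero by blast
    thus ?thesis using that[of "- k"] by simp
  qed
  define dig where "dig n y = (SOME d. d \<in> balanced_digits ?p \<and>
      padic_norm (y - of_int d * ?P n) \<le> real ?p powi (- (n + 1)))" for n y
  have dig: "dig n y \<in> balanced_digits ?p"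
      "padic_norm (y - of_int (dig n y) * ?P n) \<le> real ?p powi (- (n + 1))"
    if "padic_norm y \<le> real ?p powi (- n)" for n y
    using someI_ex[of "\<lambda>d. d \<in> balanced_digits ?p \<and>
      padic_norm (y - of_int d * ?P n) \<le> real ?p powi (- (n + 1))"]
      ex_balanced_digit_powi[OF assms that] unfolding dig_def by blast+
  define y where "y = rec_nat x (\<lambda>k z. z - of_int (dig (int k - r) z) * ?P (int k - r))"
  have y0: "y 0 = x"
    and yS: "y (Suc k) = y k - of_int (dig (int k - r) (y k)) * ?P (int k - r)" for k
    by (simp_all add: y_def)
  have bound: "padic_norm (y k) \<le> real ?p powi (- (int k - r))" for k
  proof (induction k)
    case 0
    show ?case using r by (simp add: y0)
  next
    case (Suc k)
    show ?case using dig(2)[OF Suc] unfolding yS by (simp add: algebra_simps)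
  qed
  define a where "a n = (if n < - r then 0 else dig n (y (nat (n + r))))" for n
  have a: "a (int k - r) = dig (int k - r) (y k)" for k by (simp add: a_def)
  have partial: "(\<Sum>k<m. of_int (a (int k - r)) * ?P (int k - r)) = x - y m" for m
    by (induction m) (simp_all add: y0 yS a)
  have "(\<lambda>m. \<Sum>k<m. of_int (a (int k - r)) * ?P (int k - r)) \<longlonglongrightarrow> x"
  proof (subst tendsto_dist_iff, rule tendsto_sandwich[OF _ _ tendsto_const])
    have "(\<lambda>m. inverse (real ?p) ^ m) \<longlonglongrightarrow> 0"
      using p1 by (intro LIMSEQ_realpow_zero) (auto simp: inverse_less_1_iff)
    hence "(\<lambda>m. real ?p powi r * inverse (real ?p) ^ m) \<longlonglongrightarrow> 0"
      by (rule tendsto_mult_right_zero)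
    moreover have "real ?p powi r * inverse (real ?p) ^ m = real ?p powi (- (int m - r))" for m
      using p1 by (simp add: power_int_diff field_simps)
    ultimately show "(\<lambda>m. real ?p powi (- (int m - r))) \<longlonglongrightarrow> 0" by simp
  qed (use bound in \<open>auto simp: partial dist_padic_def\<close>)
  moreover have "a n \<in> balanced_digits ?p" for n
  proof (cases "n < - r")
    case True
    have "(0::int) \<in> balanced_digits ?p" using p1 by (auto simp: balanced_digits_def)
    thus ?thesis using True by (simp add: a_def)
  next
    case False
    hence "padic_norm (y (nat (n + r))) \<le> real ?p powi (- n)" using bound[of "nat (n + r)"] by simp
    thus ?thesis using dig(1) False by (simp add: a_def)
  qed
  moreover have "a n = 0" if "n < - r" for n using that by (simp add: a_def)
  ultimately show ?thesis unfolding is_balanced_expansion_def sums_def by blast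
qed

lemma ex1_balanced_expansion:
  fixes x :: "'p::prime_card padic"
  assumes "odd CARD('p)"
  shows "\<exists>!a. is_balanced_expansion a x"
  using ex_balanced_expansion[OF assms] is_balanced_expansion_unique by blast

definition padic_digit :: "'p::prime_card padic \<Rightarrow> int \<Rightarrow> int" where
  "padic_digit x = (THE a. is_balanced_expansion a x)"


lemma is_balanced_expansion_padic_digit:
  "odd CARD('p) \<Longrightarrow> is_balanced_expansion (padic_digit x) (x :: 'p::prime_card padic)"
  unfolding padic_digit_def by (rule theI'[OF ex1_balanced_expansion])

lemma finite_padic_digits:
  fixes x :: "'p::prime_card padic"
  assumes "odd CARD('p)"
  shows "finite {n. n \<le> N \<and> padic_digit x n \<noteq> 0}"
proof -
  obtain r where "\<And>n. n < - r \<Longrightarrow> padic_digit x n = 0"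
    using is_balanced_expansion_padic_digit[OF assms, of x]
    unfolding is_balanced_expansion_def by blast
  hence "{n. n \<le> N \<and> padic_digit x n \<noteq> 0} \<subseteq> {- r..N}" by force
  thus ?thesis by (rule finite_subset) simp
qed


section \<open>The algorithm Browkin II\<close>

text \<open>
  Instead of starting at some index \<open>-r\<close> below which all digits vanish, the sums range over the
  nonzero digits only. These are finitely many by \<open>finite_padic_digits\<close>.
\<close>

definition browkin_s :: "'p::prime_card padic \<Rightarrow> rat" where
  "browkin_s x = (\<Sum>n | n \<le> 0 \<and> padic_digit x n \<noteq> 0.
     of_int (padic_digit x n) * of_nat CARD('p) powi n)"

definition browkin_t :: "'p::prime_card padic \<Rightarrow> rat" where
  "browkin_t x = (\<Sum>n | n \<le> -1 \<and> padic_digit x n \<noteq> 0.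
     of_int (padic_digit x n) * of_nat CARD('p) powi n)"

definition browkin2_step :: "nat \<Rightarrow> 'p::prime_card padic \<Rightarrow> rat" where
  "browkin2_step n x =
     (if even n then browkin_s x
      else if padic_val (x - of_rat (browkin_t x)) = Fin 0 then browkin_t x
      else browkin_t x - sgn (browkin_t x))"

text \<open>\<open>browkin2_complete x n\<close> is the \<open>n\<close>-th complete quotient; it is \<open>None\<close> once the algorithm has stopped.\<close>

primrec browkin2_complete :: "'p::prime_card padic \<Rightarrow> nat \<Rightarrow> 'p padic option" where
  "browkin2_complete x 0 = Some x"
| "browkin2_complete x (Suc n) =
     (case browkin2_complete x n of
        None \<Rightarrow> None
      | Some y \<Rightarrow>
          let b = of_rat (browkin2_step n y)
          in if y = b then None else Some (1 / (y - b)))"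

definition browkin2_expansion :: "'p::prime_card padic \<Rightarrow> nat \<Rightarrow> rat option" where
  "browkin2_expansion x n = map_option (browkin2_step n) (browkin2_complete x n)"

definition infinite_expansion :: "(nat \<Rightarrow> 'a option) \<Rightarrow> bool" where
  "infinite_expansion b \<longleftrightarrow> (\<forall>n. b n \<noteq> None)"

definition periodic_from :: "(nat \<Rightarrow> 'a option) \<Rightarrow> nat \<Rightarrow> bool" where
  "periodic_from b h \<longleftrightarrow> (\<exists>k\<ge>1. \<forall>n\<ge>h. b (n + k) = b n)"

definition periodic_expansion :: "(nat \<Rightarrow> 'a option) \<Rightarrow> bool" where
  "periodic_expansion b \<longleftrightarrow> infinite_expansion b \<and> (\<exists>h. periodic_from b h)"

definition preperiod_length :: "(nat \<Rightarrow> 'a option) \<Rightarrow> nat" where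
  "preperiod_length b = (LEAST h. periodic_from b h)"

end

theory Submission
  imports Defs
begin

text \<open>
  Write \<open>\<alpha>\<^sub>n\<close> for the complete quotients of \<open>\<delta> = \<surd>D\<close>, \<open>b\<^sub>n\<close> for the partial quotients, and
  \<open>\<alpha>'\<^sub>n\<close> for the image of \<open>\<alpha>\<^sub>n\<close> under the automorphism \<open>\<delta> \<mapsto> -\<delta>\<close> of \<open>\<rat>(\<delta>)\<close>. As the \<open>b\<^sub>n\<close> are
  rational, \<open>\<alpha>'\<^sub>n\<close> obeys the same recurrence \<open>\<alpha>'\<^sub>n = b\<^sub>n + 1/\<alpha>'\<^sub>n\<^sub>+\<^sub>1\<close> as \<open>\<alpha>\<^sub>n\<close>, but
  starts at \<open>-\<delta>\<close>. The point is that the two orbits have different sizes: for even \<open>n \<ge> 2\<close> the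
  complete quotient \<open>\<alpha>\<^sub>n\<close> is a unit, whereas \<open>|\<alpha>'\<^sub>n| < 1\<close> (lemma \<open>norm_\<alpha>'_even\<close>).

  Suppose that the \<open>b\<^sub>n\<close> repeat with period \<open>k\<close> from an odd index \<open>h = n + 1 \<ge> 3\<close> on. The sizes of the
  \<open>b\<^sub>n\<close> alternate with the parity of the index, so \<open>k\<close> is even (\<open>period_even\<close>). A complete
  quotient is determined by the partial quotients that follow it
  (\<open>padic_continued_fraction_unique\<close>), so \<open>\<alpha>\<^sub>h\<^sub>+\<^sub>k = \<alpha>\<^sub>h\<close>, and since \<open>\<delta>\<close> is irrational also
  \<open>\<alpha>'\<^sub>h\<^sub>+\<^sub>k = \<alpha>'\<^sub>h\<close>. One step back in the conjugate orbit this reads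
  \<open>b\<^sub>n\<^sub>+\<^sub>k - b\<^sub>n = \<alpha>'\<^sub>n\<^sub>+\<^sub>k - \<alpha>'\<^sub>n\<close>. The right-hand side has norm less than 1. On the left both
  terms are balanced digits, which are pairwise incongruent modulo \<open>p\<close>. Hence \<open>b\<^sub>n\<^sub>+\<^sub>k = b\<^sub>n\<close>, and
  the period already starts at \<open>n = h - 1\<close> (\<open>period_extends_to_left\<close>). So an odd preperiod length
  of at least 3 is never minimal.
\<close>

section \<open>The ultrametric norm\<close>

lemma padic_norm_one [simp]: "padic_norm (1 :: 'p::prime_card padic) = 1"
  using norm_padic_of_rat[of 1, where 'p='p] by simp

lemma padic_norm_inverse:
  "padic_norm (1 / x :: 'p::prime_card padic) = 1 / padic_norm x"
proof (cases "x = 0")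
  case False
  hence "padic_norm x * padic_norm (1 / x) = 1"
    by (simp flip: norm_padic_mult)
  thus ?thesis using False by (simp add: field_simps)
qed simp

lemma padic_norm_diff_le:
  "padic_norm (x - y :: 'p::prime_card padic) \<le> max (padic_norm x) (padic_norm y)"
  using norm_padic_ultra[of x "- y"] by simp

lemma padic_norm_diff_less:
  "padic_norm x < e \<Longrightarrow> padic_norm y < e \<Longrightarrow> padic_norm (x - y :: 'p::prime_card padic) < e"
  using padic_norm_diff_le[of x y] by linarith

lemma padic_norm_diff_dominant:
  fixes x y :: "'p::prime_card padic"
  assumes "padic_norm y < padic_norm x"
  shows "padic_norm (x - y) = padic_norm x"
proof -
  have "padic_norm x \<le> max (padic_norm (x - y)) (padic_norm y)"
    using norm_padic_ultra[of "x - y" y] by simp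
  thus ?thesis using padic_norm_diff_le[of x y] assms by linarith
qed

lemma padic_norm_eq_of_close:
  fixes x y :: "'p::prime_card padic"
  assumes "padic_norm (x - y) < padic_norm x"
  shows "padic_norm y = padic_norm x"
  using padic_norm_diff_dominant[OF assms] by simp

lemma padic_norm_double:
  fixes x :: "'p::prime_card padic"
  assumes "odd CARD('p)"
  shows "padic_norm (2 * x) = padic_norm x"
proof -
  have "\<not> int CARD('p) dvd 2"
  proof
    assume "int CARD('p) dvd 2"
    hence "int CARD('p) \<le> 2" by (rule zdvd_imp_le) simp
    thus False using assms p_gt_1[OF padic_prime[where 'a='p]] by (cases "CARD('p) = 2") auto
  qed
  hence "padic_norm (2 :: 'p padic) = 1"
    using padic_norm_of_int_less_1[of 2, where 'p='p] padic_norm_of_int_le_1[of 2, where 'p='p]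
    by simp
  thus ?thesis by (simp add: norm_padic_mult)
qed

text \<open>
  This is how the conjugate orbit first departs from the original one: subtracting an approximation
  \<open>y\<close> from \<open>x\<close> leaves a small remainder, but \<open>-x - y\<close> is close to \<open>-2x\<close>, and 2 is a unit.
\<close>

lemma padic_norm_neg_diff:
  fixes x y :: "'p::prime_card padic"
  assumes "odd CARD('p)" "padic_norm (x - y) < padic_norm x"
  shows "padic_norm (- x - y) = padic_norm x"
proof -
  have "- x - y = - (2 * x - (x - y))" by simp
  hence "padic_norm (- x - y) = padic_norm (2 * x - (x - y))" by (metis norm_padic_minus)
  also have "\<dots> = padic_norm x"
    using padic_norm_diff_dominant[of "x - y" "2 * x"] padic_norm_double[OF assms(1), of x] assms(2)
    by simp
  finally show ?thesis .
qed

lemma padic_val_eq_0_iff: "padic_val (x :: 'p::prime_card padic) = Fin 0 \<longleftrightarrow> padic_norm x = 1"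
proof (cases "x = 0")
  case False
  have "(THE k. padic_norm x = real CARD('p) powi (- k)) = 0 \<longleftrightarrow> padic_norm x = 1"
    using theI'[OF norm_padic_nonzero[OF False]] the1_equality[OF norm_padic_nonzero[OF False], of 0]
    by auto
  thus ?thesis using False by (simp add: padic_val_def)
qed (simp add: padic_val_def)


section \<open>Truncated digit expansions\<close>

lemma padic_digit_balanced:
  fixes x :: "'p::prime_card padic"
  assumes "odd CARD('p)"
  shows "padic_digit x n \<in> balanced_digits CARD('p)"
  using is_balanced_expansion_padic_digit[OF assms, of x]
  unfolding is_balanced_expansion_def by blast

lemma balanced_digits_eqI:
  assumes "a \<in> balanced_digits CARD('p)" "b \<in> balanced_digits CARD('p)"
    and "padic_norm (of_int a - of_int b :: 'p::prime_card padic) < 1"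
  shows "a = b"
proof (rule ccontr)
  assume "a \<noteq> b"
  moreover have "int CARD('p) dvd a - b"
    using assms(3) padic_norm_of_int_less_1[of "a - b", where 'p='p] by simp
  ultimately have "int CARD('p) \<le> \<bar>a - b\<bar>" using dvd_imp_le_int[of "a - b" "int CARD('p)"] by simp
  moreover have "\<bar>a - b\<bar> < int CARD('p)"
    using assms(1,2) p_gt_1[OF padic_prime[where 'a='p]] by (auto simp: balanced_digits_def)
  ultimately show False by simp
qed

text \<open>
  With \<open>M = 0\<close> and \<open>M = -1\<close> this bounds the error of \<open>browkin_s\<close> and of \<open>browkin_t\<close>.
\<close>

lemma padic_norm_truncation:
  fixes x :: "'p::prime_card padic"
  assumes "odd CARD('p)"
  shows "padic_norm (x - of_rat (\<Sum>n | n \<le> M \<and> padic_digit x n \<noteq> 0.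
           of_int (padic_digit x n) * of_nat CARD('p) powi n)) \<le> real CARD('p) powi (- M - 1)"
proof -
  let ?g = "\<lambda>n. of_int (padic_digit x n) * of_nat CARD('p) powi n"
  obtain r where r: "\<And>n. n < - r \<Longrightarrow> padic_digit x n = 0"
    "\<And>R N. R \<ge> r \<Longrightarrow> padic_norm (x - (\<Sum>n=-R..<N. ?g n)) \<le> real CARD('p) powi (- N)"
    using is_balanced_expansion_approx[OF is_balanced_expansion_padic_digit[OF assms, of x]] by metis
  have "of_rat (of_nat CARD('p) powi n) = (of_nat CARD('p) powi n :: 'p padic)" for n
    by (simp add: power_int_def of_rat_power of_rat_inverse)
  hence "of_rat (\<Sum>n | n \<le> M \<and> padic_digit x n \<noteq> 0. ?g n) =
      (\<Sum>n | n \<le> M \<and> padic_digit x n \<noteq> 0. ?g n :: 'p padic)"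
    by (simp add: of_rat_sum of_rat_mult)
  also have "\<dots> = (\<Sum>n=-r..<M+1. ?g n)"
    by (rule sum.mono_neutral_left) (auto simp: not_less[symmetric] dest: r(1))
  finally show ?thesis using r(2)[of r "M + 1"] by simp
qed

text \<open>
  Nonzero balanced digits are units, so the norm of \<open>x\<close> is that of the term of its lowest nonzero
  digit.
\<close>

lemma padic_digit_eq_0:
  fixes x :: "'p::prime_card padic"
  assumes "odd CARD('p)" "padic_norm x \<le> real CARD('p) powi (- N)" "n < N"
  shows "padic_digit x n = 0"
proof (rule ccontr)
  let ?g = "\<lambda>n. of_int (padic_digit x n) * of_nat CARD('p) powi n :: 'p padic"
  have p1: "real CARD('p) > 1" by (rule p_gt_1[OF padic_prime])
  assume nz: "padic_digit x n \<noteq> 0"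
  define A where "A = {m. m \<le> n \<and> padic_digit x m \<noteq> 0}"
  define m where "m = Min A"
  have "finite A" "A \<noteq> {}" using finite_padic_digits[OF assms(1)] nz by (auto simp: A_def)
  hence "m \<in> A" and min: "\<And>j. j \<in> A \<Longrightarrow> m \<le> j" unfolding m_def by auto
  hence m: "m \<le> n" "padic_digit x m \<noteq> 0" by (auto simp: A_def)
  have below: "padic_digit x j = 0" if "j < m" for j
    using min[of j] m(1) that by (auto simp: A_def)
  obtain r where r:
    "\<And>R N. R \<ge> r \<Longrightarrow> padic_norm (x - (\<Sum>n=-R..<N. ?g n)) \<le> real CARD('p) powi (- N)"
    using is_balanced_expansion_approx[OF is_balanced_expansion_padic_digit[OF assms(1), of x]] by metis
  have "(\<Sum>n=- max r (- m)..<m+1. ?g n) = (\<Sum>n\<in>{m}. ?g n)"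
    by (rule sum.mono_neutral_right) (auto simp: below)
  hence "padic_norm (x - ?g m) \<le> real CARD('p) powi (- (m + 1))"
    using r[of "max r (- m)" "m + 1"] by simp
  also have lt: "real CARD('p) powi (- (m + 1)) < real CARD('p) powi (- m)"
    using p1 by (intro power_int_strict_increasing) auto
  finally have close: "padic_norm (x - ?g m) < real CARD('p) powi (- m)" .
  have "padic_norm (of_int (padic_digit x m) :: 'p padic) = 1"
  proof (rule ccontr)
    assume "\<not> ?thesis"
    hence "padic_norm (of_int (padic_digit x m) - of_int 0 :: 'p padic) < 1"
      using padic_norm_of_int_le_1[of "padic_digit x m", where 'p='p] by simp
    moreover have "0 \<in> balanced_digits CARD('p)" using p1 by (auto simp: balanced_digits_def)
    ultimately show False
      using balanced_digits_eqI padic_digit_balanced[OF assms(1)] m(2) by blast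
  qed
  hence "padic_norm (?g m) = real CARD('p) powi (- m)"
    by (simp add: norm_padic_mult padic_norm_p_powi)
  moreover have "padic_norm x < real CARD('p) powi (- m)"
  proof -
    have "real CARD('p) powi (- N) < real CARD('p) powi (- m)"
      using p1 m(1) assms(3) by (intro power_int_strict_increasing) auto
    thus ?thesis using assms(2) by simp
  qed
  ultimately have "padic_norm (x - (x - ?g m)) < padic_norm (?g m)"
    using padic_norm_diff_less[OF _ close, of x] by simp
  thus False by simp
qed

lemma padic_norm_diff_browkin_s:
  fixes x :: "'p::prime_card padic"
  assumes "odd CARD('p)"
  shows "padic_norm (x - of_rat (browkin_s x)) \<le> 1 / real CARD('p)"
  using padic_norm_truncation[OF assms, of x 0]
  by (simp add: browkin_s_def power_int_minus divide_inverse)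

lemma padic_norm_diff_browkin_t:
  fixes x :: "'p::prime_card padic"
  assumes "odd CARD('p)"
  shows "padic_norm (x - of_rat (browkin_t x)) \<le> 1"
  using padic_norm_truncation[OF assms, of x "-1"] by (simp add: browkin_t_def)

lemma browkin_s_eq_digit:
  fixes x :: "'p::prime_card padic"
  assumes "odd CARD('p)" "padic_norm x \<le> 1"
  shows "browkin_s x = of_int (padic_digit x 0)"
proof -
  have "padic_digit x n = 0" if "n < 0" for n
    using padic_digit_eq_0[of x 0 n] assms that by simp
  hence "{n. n \<le> 0 \<and> padic_digit x n \<noteq> 0} = (if padic_digit x 0 = 0 then {} else {0})"
    by (auto simp: le_less)
  thus ?thesis by (simp add: browkin_s_def)
qed

lemma browkin_s_eq_0:
  fixes x :: "'p::prime_card padic"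
  assumes "odd CARD('p)" "padic_norm x < 1"
  shows "browkin_s x = 0"
proof -
  have "padic_norm x \<le> real CARD('p) powi (- 1)"
    using padic_norm_less_powiD[of x 0] assms(2) by simp
  hence "padic_digit x 0 = 0" using padic_digit_eq_0[of x 1 0] assms(1) by simp
  thus ?thesis using browkin_s_eq_digit[of x] assms by simp
qed


section \<open>Continued fractions converge\<close>

text \<open>
  For two tails with the same partial quotients, \<open>x\<^sub>n - y\<^sub>n = -(x\<^sub>n\<^sub>+\<^sub>1 - y\<^sub>n\<^sub>+\<^sub>1) / (x\<^sub>n\<^sub>+\<^sub>1 y\<^sub>n\<^sub>+\<^sub>1)\<close>. A
  single step need not contract, because in Browkin II every second complete quotient is only a unit,
  so the gain of a factor \<open>q > 1\<close> is taken over two consecutive steps.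
\<close>

lemma padic_continued_fraction_unique:
  fixes x y :: "nat \<Rightarrow> 'p::prime_card padic"
  assumes x: "\<And>n. x n = c n + 1 / x (Suc n)" and y: "\<And>n. y n = c n + 1 / y (Suc n)"
    and x1: "\<And>n. padic_norm (x (Suc n)) \<ge> 1" and y1: "\<And>n. padic_norm (y (Suc n)) \<ge> 1"
    and q: "q > 1" "\<And>n. padic_norm (x (Suc n)) * padic_norm (x (Suc (Suc n))) \<ge> q"
  shows "x n = y n"
proof -
  let ?d = "\<lambda>n. padic_norm (x n - y n)"
  have step: "?d n * (padic_norm (x (Suc n)) * padic_norm (y (Suc n))) = ?d (Suc n)" for n
  proof -
    have "x (Suc n) \<noteq> 0" "y (Suc n) \<noteq> 0" using x1[of n] y1[of n] by force+
    hence "(x n - y n) * (x (Suc n) * y (Suc n)) = - (x (Suc n) - y (Suc n))"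
      by (simp add: x[of n] y[of n] divide_simps) (simp add: algebra_simps)
    thus ?thesis by (metis norm_padic_minus norm_padic_mult)
  qed
  have two: "?d n * q \<le> ?d (Suc (Suc n))" for n
  proof -
    have "q * 1 \<le> (padic_norm (x (Suc n)) * padic_norm (x (Suc (Suc n)))) *
        (padic_norm (y (Suc n)) * padic_norm (y (Suc (Suc n))))"
      using q(1) q(2)[of n] mult_mono[OF y1[of n] y1[of "Suc n"]] by (intro mult_mono) auto
    hence "?d n * q \<le> ?d n * ((padic_norm (x (Suc n)) * padic_norm (x (Suc (Suc n)))) *
        (padic_norm (y (Suc n)) * padic_norm (y (Suc (Suc n)))))"
      by (intro mult_left_mono) auto
    also have "\<dots> = ?d (Suc (Suc n))"
      unfolding step[symmetric] by (simp add: mult_ac)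
    finally show ?thesis .
  qed
  \<comment> \<open>The partial quotients cancel in the difference, which leaves two terms of norm at most 1.\<close>
  have one: "?d n \<le> 1" for n
  proof -
    have eq: "x n - y n = 1 / x (Suc n) - 1 / y (Suc n)" using x[of n] y[of n] by (simp only: add_diff_cancel_left)
    have "padic_norm (1 / x (Suc n)) \<le> 1" "padic_norm (1 / y (Suc n)) \<le> 1"
      using x1[of n] y1[of n] by (simp_all add: padic_norm_inverse)
    thus ?thesis unfolding eq using padic_norm_diff_le[of "1 / x (Suc n)" "1 / y (Suc n)"] by linarith
  qed
  have bound: "?d n * q ^ j \<le> 1" for n j
  proof (induction j arbitrary: n)
    case 0
    show ?case using one by simp
  next
    case (Suc j)
    have "?d n * q ^ Suc j = (?d n * q) * q ^ j" by simp
    also have "\<dots> \<le> ?d (Suc (Suc n)) * q ^ j" using two q(1) by (intro mult_right_mono) auto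
    also have "\<dots> \<le> 1" by (rule Suc.IH)
    finally show ?case .
  qed
  have "?d n = 0"
  proof (rule ccontr)
    assume "?d n \<noteq> 0"
    hence pos: "?d n > 0" using norm_padic_nonneg[of "x n - y n"] by linarith
    obtain j where "1 / ?d n < q ^ j" using real_arch_pow[OF q(1)] by blast
    hence "1 < ?d n * q ^ j" using pos by (simp add: field_simps)
    thus False using bound[of n j] by simp
  qed
  thus ?thesis by simp
qed


section \<open>Conjugation\<close>

lemma not_square_of_rat:
  fixes D :: int
  assumes "\<not> (\<exists>m::int. D = m\<^sup>2)"
  shows "u\<^sup>2 \<noteq> (of_int D :: rat)"
proof
  assume eq: "u\<^sup>2 = of_int D"
  obtain a b where ab: "quotient_of u = (a, b)" by (cases "quotient_of u")
  have u: "u = of_int a / of_int b" and b: "b > 0" and cop: "coprime a b"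
    using quotient_of_div[OF ab] quotient_of_denom_pos[OF ab] quotient_of_coprime[OF ab] by auto
  have "of_int (a\<^sup>2) = (of_int (D * b\<^sup>2) :: rat)"
    using eq b by (simp add: u field_simps)
  hence "a\<^sup>2 = D * b\<^sup>2" by (simp only: of_int_eq_iff)
  hence "b dvd a * a" by (simp add: power2_eq_square)
  hence "b dvd a" using cop by (metis coprime_commute coprime_dvd_mult_left_iff)
  hence "b = 1" using cop b by (metis coprime_common_divisor dvd_refl zdvd1_eq abs_of_pos)
  thus False using \<open>a\<^sup>2 = D * b\<^sup>2\<close> assms by auto
qed

context
  fixes D :: int and \<delta> :: "'a::field_char_0"
  assumes D: "\<not> (\<exists>m::int. D = m\<^sup>2)" and \<delta>: "\<delta>\<^sup>2 = of_int D"
begin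

lemma sqrt_irrational: "\<delta> \<noteq> of_rat u"
proof
  assume "\<delta> = of_rat u"
  hence "of_rat (u\<^sup>2) = (of_rat (of_int D) :: 'a)" using \<delta> by (simp add: of_rat_power)
  thus False using not_square_of_rat[OF D, of u] by (simp only: of_rat_eq_iff)
qed

lemma sqrt_coordinates_unique:
  assumes "of_rat u + of_rat v * \<delta> = of_rat u' + of_rat v' * \<delta>"
  shows "u = u'" "v = v'"
proof -
  show v: "v = v'"
  proof (rule ccontr)
    assume "v \<noteq> v'"
    hence "of_rat (v - v') \<noteq> (0 :: 'a)" by simp
    moreover have "of_rat (v - v') * \<delta> = of_rat (u' - u)"
      using assms by (simp add: of_rat_diff algebra_simps)
    ultimately have "\<delta> = of_rat ((u' - u) / (v - v'))"
      by (simp add: of_rat_divide field_simps)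
    thus False using sqrt_irrational by blast
  qed
  show "u = u'" using assms v by simp
qed

text \<open>
  The graph of the automorphism \<open>\<delta> \<mapsto> -\<delta>\<close> of \<open>\<rat>(\<delta>)\<close>; a relation, because elements of the ambient
  field outside \<open>\<rat>(\<delta>)\<close> have no conjugate.
\<close>

definition conjugates :: "'a \<Rightarrow> 'a \<Rightarrow> bool" where
  "conjugates x x' \<longleftrightarrow> (\<exists>u v. x = of_rat u + of_rat v * \<delta> \<and> x' = of_rat u - of_rat v * \<delta>)"

lemma conjugates_sqrt: "conjugates \<delta> (- \<delta>)"
  unfolding conjugates_def by (rule exI[of _ 0], rule exI[of _ 1]) simp

lemma conjugates_unique: "conjugates x x' \<Longrightarrow> conjugates x x'' \<Longrightarrow> x' = x''"
  unfolding conjugates_def using sqrt_coordinates_unique by metis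

lemma conjugates_diff_of_rat: "conjugates x x' \<Longrightarrow> conjugates (x - of_rat c) (x' - of_rat c)"
  unfolding conjugates_def
proof (elim exE conjE)
  fix u v
  assume "x = of_rat u + of_rat v * \<delta>" "x' = of_rat u - of_rat v * \<delta>"
  thus "\<exists>u v. x - of_rat c = of_rat u + of_rat v * \<delta> \<and> x' - of_rat c = of_rat u - of_rat v * \<delta>"
    by (intro exI[of _ "u - c"] exI[of _ v]) (simp add: of_rat_diff)
qed

lemma conjugates_inverse:
  assumes "conjugates x x'"
  shows "conjugates (1 / x) (1 / x')"
proof -
  obtain u v where x: "x = of_rat u + of_rat v * \<delta>" and x': "x' = of_rat u - of_rat v * \<delta>"
    using assms unfolding conjugates_def by blast
  \<comment> \<open>\<open>N\<close> is the field norm of \<open>x\<close>, which vanishes only for \<open>x = 0\<close>.\<close>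
  define N where "N = u\<^sup>2 - v\<^sup>2 * of_int D"
  have N: "x * x' = of_rat N"
    by (simp add: x x' N_def of_rat_diff of_rat_mult of_rat_power algebra_simps power2_eq_square
          flip: \<delta>)
  show ?thesis
  proof (cases "N = 0")
    case True
    have "v = 0"
    proof (rule ccontr)
      assume "v \<noteq> 0"
      hence "(u / v)\<^sup>2 = of_int D" using True by (simp add: N_def field_simps)
      thus False using not_square_of_rat[OF D] by blast
    qed
    hence "u = 0" using True by (simp add: N_def)
    thus ?thesis using \<open>v = 0\<close> unfolding conjugates_def x x'
      by (intro exI[of _ 0]) simp
  next
    case False
    hence "x \<noteq> 0" "x' \<noteq> 0" "(of_rat N :: 'a) \<noteq> 0" using N by auto
    hence "1 / x = x' / of_rat N" "1 / x' = x / of_rat N" by (simp_all add: field_simps flip: N)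
    thus ?thesis unfolding conjugates_def x x'
      by (intro exI[of _ "u / N"] exI[of _ "- v / N"])
         (simp add: of_rat_divide of_rat_minus diff_divide_distrib add_divide_distrib)
  qed
qed

end


section \<open>Norms along an infinite run of the algorithm\<close>

locale browkin2_run =
  fixes \<alpha> :: "nat \<Rightarrow> 'p::prime_card padic" and b :: "nat \<Rightarrow> rat"
  assumes odd_p: "odd CARD('p)"
    and b: "\<And>n. b n = browkin2_step n (\<alpha> n)"
    and no_stop: "\<And>n. \<alpha> n \<noteq> of_rat (b n)"
    and \<alpha>_Suc: "\<And>n. \<alpha> (Suc n) = 1 / (\<alpha> n - of_rat (b n))"
begin

lemma p_gt_1': "real CARD('p) > 1"
  by (rule p_gt_1[OF padic_prime])

lemma \<alpha>_unfold: "\<alpha> n = of_rat (b n) + 1 / \<alpha> (Suc n)"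
  by (simp add: \<alpha>_Suc)

lemma norm_remainder_even: "even n \<Longrightarrow> padic_norm (\<alpha> n - of_rat (b n)) \<le> 1 / real CARD('p)"
  by (simp add: b browkin2_step_def padic_norm_diff_browkin_s[OF odd_p])

lemma norm_\<alpha>_odd:
  assumes "odd n"
  shows "padic_norm (\<alpha> n) \<ge> real CARD('p)"
proof -
  obtain m where n: "n = Suc m" "even m" using assms by (cases n) auto
  have "padic_norm (\<alpha> m - of_rat (b m)) > 0"
    using no_stop[of m] by (simp add: less_le)
  thus ?thesis using norm_remainder_even[OF n(2)] p_gt_1' 
    by (simp add: n \<alpha>_Suc padic_norm_inverse field_simps)
qed

text \<open>
  This is the purpose of the sign correction in Browkin II: if \<open>\<alpha>\<^sub>n - t(\<alpha>\<^sub>n)\<close> is not a unit, then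
  its norm is less than 1, and adding \<open>\<plusminus>1\<close> turns it into a unit.
\<close>

lemma norm_remainder_odd:
  assumes "odd n"
  shows "padic_norm (\<alpha> n - of_rat (b n)) = 1"
proof (cases "padic_norm (\<alpha> n - of_rat (browkin_t (\<alpha> n))) = 1")
  case True
  thus ?thesis using assms by (simp add: b browkin2_step_def padic_val_eq_0_iff)
next
  case False
  let ?t = "browkin_t (\<alpha> n)"
  have lt: "padic_norm (\<alpha> n - of_rat ?t) < 1"
    using padic_norm_diff_browkin_t[OF odd_p, of "\<alpha> n"] False by simp
  hence "?t \<noteq> 0" using norm_\<alpha>_odd[OF assms] p_gt_1' by auto
  hence sgn: "padic_norm (of_rat (sgn ?t) :: 'p padic) = 1"
    by (simp add: sgn_if)
  have "\<alpha> n - of_rat (b n) = - (- of_rat (sgn ?t) - (\<alpha> n - of_rat ?t))"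
    using assms False by (simp add: b browkin2_step_def padic_val_eq_0_iff of_rat_diff)
  thus ?thesis using padic_norm_diff_dominant[of "\<alpha> n - of_rat ?t" "- of_rat (sgn ?t)"] lt sgn
    by (metis norm_padic_minus)
qed

lemma norm_\<alpha>_even:
  assumes "even n" "n \<ge> 2"
  shows "padic_norm (\<alpha> n) = 1"
proof -
  obtain m where n: "n = Suc m" "odd m" using assms by (cases n) auto
  show ?thesis using norm_remainder_odd[OF n(2)] by (simp add: n \<alpha>_Suc padic_norm_inverse)
qed

lemma norm_\<alpha>_ge_1:
  assumes "n \<ge> 1"
  shows "padic_norm (\<alpha> n) \<ge> 1"
proof (cases "even n")
  case True
  hence "n \<ge> 2" using assms by (cases "n = 1") auto
  thus ?thesis using norm_\<alpha>_even True by simp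
qed (use norm_\<alpha>_odd[of n] p_gt_1' in simp)

lemma norm_b_odd: "odd n \<Longrightarrow> padic_norm (of_rat (b n) :: 'p padic) > 1"
  using padic_norm_eq_of_close[of "\<alpha> n" "of_rat (b n)"] norm_remainder_odd[of n]
    norm_\<alpha>_odd[of n] p_gt_1' by simp

lemma b_even_digit:
  assumes "even n" "n \<ge> 2"
  obtains d where "d \<in> balanced_digits CARD('p)" "b n = of_int d"
  using that[OF padic_digit_balanced[OF odd_p, of "\<alpha> n" 0]]
    browkin_s_eq_digit[OF odd_p, of "\<alpha> n"] norm_\<alpha>_even[OF assms] assms(1)
  by (simp add: b browkin2_step_def)

lemma norm_b_even:
  assumes "even n" "n \<ge> 2"
  shows "padic_norm (of_rat (b n) :: 'p padic) = 1"
proof -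
  have "padic_norm (\<alpha> n - of_rat (b n)) < 1"
    using norm_remainder_even[OF assms(1)] p_gt_1' by (simp add: order_le_less_trans)
  thus ?thesis
    using padic_norm_eq_of_close[of "\<alpha> n" "of_rat (b n)"] norm_\<alpha>_even[OF assms] by simp
qed

lemma period_even:
  assumes "n \<ge> 2" "\<And>m. m \<ge> n \<Longrightarrow> b (m + k) = b m"
  shows "even k"
proof (rule ccontr)
  assume k: "odd k"
  have "b (2 * n + k) = b (2 * n)" using assms by simp
  thus False using norm_b_even[of "2 * n"] norm_b_odd[of "2 * n + k"] k assms(1) by simp
qed

text \<open>
  Of two consecutive complete quotients, one has odd index and thus norm at least \<open>p\<close>, so tails
  contract by the factor \<open>q = p\<close>.
\<close>

lemma \<alpha>_periodic:
  assumes "h \<ge> 1" "\<And>n. n \<ge> h \<Longrightarrow> b (n + k) = b n"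
  shows "\<alpha> (h + k) = \<alpha> h"
proof -
  have "\<alpha> (h + 0) = \<alpha> (h + k + 0)"
  proof (rule padic_continued_fraction_unique[of "\<lambda>n. \<alpha> (h + n)" "\<lambda>n. of_rat (b (h + n))"
            "\<lambda>n. \<alpha> (h + k + n)" "real CARD('p)"])
    show "\<alpha> (h + n) = of_rat (b (h + n)) + 1 / \<alpha> (h + Suc n)" for n
      using \<alpha>_unfold[of "h + n"] by simp
    show "\<alpha> (h + k + n) = of_rat (b (h + n)) + 1 / \<alpha> (h + k + Suc n)" for n
      using \<alpha>_unfold[of "h + k + n"] assms(2)[of "h + n"] by (simp add: add_ac)
    show "real CARD('p) \<le> padic_norm (\<alpha> (h + Suc n)) * padic_norm (\<alpha> (h + Suc (Suc n)))" for n
    proof (cases "odd (h + Suc n)")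
      case True
      thus ?thesis using mult_mono[OF norm_\<alpha>_odd[of "h + Suc n"] norm_\<alpha>_ge_1[of "h + Suc (Suc n)"]]
        by simp
    next
      case False
      thus ?thesis using mult_mono[OF norm_\<alpha>_ge_1[of "h + Suc n"] norm_\<alpha>_odd[of "h + Suc (Suc n)"]]
        by simp
    qed
  qed (use norm_\<alpha>_ge_1 p_gt_1' in simp_all)
  thus ?thesis by simp
qed

text \<open>
  If \<open>\<alpha> 0\<close> is an irrational square root of an integer, then \<open>\<alpha>' n\<close> is the conjugate of \<open>\<alpha> n\<close>.
\<close>

primrec \<alpha>' :: "nat \<Rightarrow> 'p padic" where
  "\<alpha>' 0 = - \<alpha> 0"
| "\<alpha>' (Suc n) = 1 / (\<alpha>' n - of_rat (b n))"

text \<open>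
  The two cases correspond to where the sign of the starting value takes effect. If \<open>|\<alpha>\<^sub>0| < 1\<close>,
  then \<open>b\<^sub>0 = 0\<close> and the orbits still agree up to sign at index 1, where \<open>-\<alpha>\<^sub>1 - b\<^sub>1\<close> is as large
  as \<open>\<alpha>\<^sub>1\<close>. Otherwise \<open>-\<alpha>\<^sub>0 - b\<^sub>0\<close> is as large as \<open>\<alpha>\<^sub>0\<close>, which makes \<open>\<alpha>'\<^sub>1\<close> integral, and \<open>b\<^sub>1\<close> dominates.
\<close>

lemma norm_\<alpha>'_1: "padic_norm (\<alpha>' 1 - of_rat (b 1)) > 1"
proof (cases "padic_norm (\<alpha> 0) < 1")
  case True
  hence "b 0 = 0" using browkin_s_eq_0[OF odd_p] by (simp add: b browkin2_step_def)
  hence "\<alpha>' 1 = - \<alpha> 1" using \<alpha>_Suc[of 0] by simp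
  moreover have "padic_norm (- \<alpha> 1 - of_rat (b 1)) = padic_norm (\<alpha> 1)"
    using norm_remainder_odd[of 1] norm_\<alpha>_odd[of 1] p_gt_1' by (intro padic_norm_neg_diff[OF odd_p]) simp
  ultimately show ?thesis using norm_\<alpha>_odd[of 1] p_gt_1' by simp
next
  case False
  have "padic_norm (\<alpha> 0 - of_rat (b 0)) < 1"
    using norm_remainder_even[of 0] p_gt_1' by (simp add: order_le_less_trans)
  hence "padic_norm (- \<alpha> 0 - of_rat (b 0)) = padic_norm (\<alpha> 0)"
    using False by (intro padic_norm_neg_diff[OF odd_p]) simp
  hence "padic_norm (\<alpha>' 1) \<le> 1" using False by (simp add: padic_norm_inverse)
  hence "padic_norm (of_rat (b 1) - \<alpha>' 1) = padic_norm (of_rat (b 1) :: 'p padic)"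
    using norm_b_odd[of 1] by (intro padic_norm_diff_dominant) simp
  thus ?thesis using norm_b_odd[of 1] norm_padic_minus[of "\<alpha>' 1 - of_rat (b 1)"] by simp
qed

text \<open>
  Once \<open>|\<alpha>'\<^sub>n| < 1\<close> for an even \<open>n \<ge> 2\<close>, the partial quotients dominate: \<open>b\<^sub>n\<close> is a unit, which
  makes \<open>\<alpha>'\<^sub>n\<^sub>+\<^sub>1\<close> a unit, and \<open>|b\<^sub>n\<^sub>+\<^sub>1| > 1\<close> then makes \<open>|\<alpha>'\<^sub>n\<^sub>+\<^sub>2| < 1\<close>.
\<close>

lemma norm_\<alpha>'_even: "padic_norm (\<alpha>' (2 * m + 2)) < 1"
proof (induction m)
  case 0
  have "\<alpha>' (2 * 0 + 2) = 1 / (\<alpha>' 1 - of_rat (b 1))" by (simp add: numeral_2_eq_2)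
  thus ?case using norm_\<alpha>'_1 by (simp only: padic_norm_inverse) simp
next
  case (Suc m)
  let ?n = "2 * m + 2"
  have "padic_norm (of_rat (b ?n) - \<alpha>' ?n) = 1"
    using padic_norm_diff_dominant[of "\<alpha>' ?n" "of_rat (b ?n)"] norm_b_even[of ?n] Suc by simp
  hence "padic_norm (\<alpha>' ?n - of_rat (b ?n)) = 1"
    using norm_padic_minus[of "\<alpha>' ?n - of_rat (b ?n)"] by simp
  hence "padic_norm (\<alpha>' (Suc ?n)) = 1" by (simp add: padic_norm_inverse)
  moreover have gt: "padic_norm (of_rat (b (Suc ?n)) :: 'p padic) > 1" by (rule norm_b_odd) simp
  ultimately have "padic_norm (of_rat (b (Suc ?n)) - \<alpha>' (Suc ?n)) > 1"
    using padic_norm_diff_dominant[of "\<alpha>' (Suc ?n)" "of_rat (b (Suc ?n))"] by (simp del: \<alpha>'.simps)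
  hence "padic_norm (\<alpha>' (Suc ?n) - of_rat (b (Suc ?n))) > 1"
    using norm_padic_minus[of "\<alpha>' (Suc ?n) - of_rat (b (Suc ?n))"] by (simp del: \<alpha>'.simps)
  hence "padic_norm (\<alpha>' (Suc (Suc ?n))) < 1"
    by (subst \<alpha>'.simps(2)) (simp add: padic_norm_inverse del: \<alpha>'.simps)
  thus ?case by (simp del: \<alpha>'.simps)
qed

text \<open>
  The parity of \<open>n\<close> enters twice: it makes \<open>|\<alpha>'\<^sub>n|\<close> and \<open>|\<alpha>'\<^sub>n\<^sub>+\<^sub>k|\<close> less than 1, and it makes
  \<open>b\<^sub>n\<close> and \<open>b\<^sub>n\<^sub>+\<^sub>k\<close> single balanced digits, for which being congruent modulo \<open>p\<close> means being equal.
\<close>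

lemma period_extends_to_left:
  assumes D: "\<not> (\<exists>m::int. D = m\<^sup>2)" "(\<alpha> 0)\<^sup>2 = of_int D"
    and n: "even n" "n \<ge> 2"
    and periodic: "\<And>m. m \<ge> Suc n \<Longrightarrow> b (m + k) = b m"
  shows "b (n + k) = b n"
proof -
  have conj: "conjugates (\<alpha> 0) (\<alpha> m) (\<alpha>' m)" for m
  proof (induction m)
    case (Suc m)
    thus ?case unfolding \<alpha>_Suc \<alpha>'.simps
      by (intro conjugates_inverse[OF D] conjugates_diff_of_rat[OF D])
  qed (simp add: conjugates_sqrt[OF D])
  have k: "even k" using period_even[of "Suc n" k] n(2) periodic by simp
  have "\<alpha> (Suc n + k) = \<alpha> (Suc n)" using \<alpha>_periodic[of "Suc n" k] periodic by simp
  hence "\<alpha>' (Suc n + k) = \<alpha>' (Suc n)"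
    using conj conjugates_unique[OF D] by metis
  hence "\<alpha>' (n + k) - of_rat (b (n + k)) = \<alpha>' n - of_rat (b n)" by simp
  hence diff: "of_rat (b (n + k)) - of_rat (b n) = \<alpha>' (n + k) - \<alpha>' n" by (simp add: algebra_simps)
  have small: "padic_norm (\<alpha>' m) < 1" if "even m" "m \<ge> 2" for m
  proof -
    have "m = 2 * (m div 2 - 1) + 2" using that by presburger
    thus ?thesis using norm_\<alpha>'_even by metis
  qed
  have "padic_norm (of_rat (b (n + k)) - of_rat (b n) :: 'p padic) < 1"
    unfolding diff using small n k by (intro padic_norm_diff_less) auto
  moreover obtain d where "d \<in> balanced_digits CARD('p)" "b n = of_int d"
    using b_even_digit[OF n] .
  moreover obtain e where "e \<in> balanced_digits CARD('p)" "b (n + k) = of_int e"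
    using b_even_digit[of "n + k"] n k by auto
  ultimately show ?thesis using balanced_digits_eqI[of e d, where 'p='p] by simp
qed

end


section \<open>The preperiod of a square root\<close>

lemma infinite_expansion_run:
  fixes \<delta> :: "'p::prime_card padic"
  assumes "odd CARD('p)" "infinite_expansion (browkin2_expansion \<delta>)"
  obtains \<alpha> b where "browkin2_run \<alpha> b" "\<alpha> 0 = \<delta>" "\<And>n. browkin2_expansion \<delta> n = Some (b n)"
proof -
  define \<alpha> where "\<alpha> n = the (browkin2_complete \<delta> n)" for n
  define b where "b n = browkin2_step n (\<alpha> n)" for n
  have \<alpha>: "browkin2_complete \<delta> n = Some (\<alpha> n)" for n
    using assms(2) unfolding infinite_expansion_def browkin2_expansion_def \<alpha>_def
    by (metis option.collapse option.map_disc_iff)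
  have "\<alpha> n \<noteq> of_rat (b n) \<and> \<alpha> (Suc n) = 1 / (\<alpha> n - of_rat (b n))" for n
    using \<alpha>[of "Suc n"] \<alpha>[of n] by (auto simp: b_def Let_def split: if_splits)
  hence "browkin2_run \<alpha> b" using assms(1) by unfold_locales (auto simp: b_def)
  moreover have "\<alpha> 0 = \<delta>" by (simp add: \<alpha>_def)
  moreover have "browkin2_expansion \<delta> n = Some (b n)" for n
    by (simp add: browkin2_expansion_def \<alpha> b_def)
  ultimately show thesis using that by blast
qed

theorem proposition15:
  fixes D :: int and \<delta> :: "'p::prime_card padic"
  assumes "odd CARD('p)"
    and "\<not> (\<exists>m::int. D = m\<^sup>2)"
    and "\<delta>\<^sup>2 = of_int D"
    and "periodic_expansion (browkin2_expansion \<delta>)"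
  shows "preperiod_length (browkin2_expansion \<delta>) = 1 \<or>
         even (preperiod_length (browkin2_expansion \<delta>))"
proof (rule ccontr)
  let ?e = "browkin2_expansion \<delta>"
  define h where "h = preperiod_length ?e"
  assume "\<not> ?thesis"
  hence "odd h" "h \<noteq> 1" by (auto simp: h_def)
  then obtain c where "h = Suc (2 * c)" "c \<noteq> 0" by (auto elim!: oddE)
  then obtain n where n: "h = Suc n" "even n" "n \<ge> 2" by (intro that[of "2 * c"]) auto
  obtain \<alpha> b where run: "browkin2_run \<alpha> b" and \<alpha>0: "\<alpha> 0 = \<delta>" and b: "\<And>n. ?e n = Some (b n)"
    using infinite_expansion_run[OF assms(1)] assms(4) unfolding periodic_expansion_def by metis
  have "periodic_from ?e h"
    using assms(4) unfolding h_def preperiod_length_def periodic_expansion_def by (metis LeastI)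
  then obtain k where k: "k \<ge> 1" "\<And>m. m \<ge> Suc n \<Longrightarrow> b (m + k) = b m"
    unfolding periodic_from_def b n(1) by auto
  have "b (n + k) = b n"
    using browkin2_run.period_extends_to_left[OF run assms(2) _ n(2,3) k(2)] \<alpha>0 assms(3) by simp
  hence "b (m + k) = b m" if "m \<ge> n" for m
    using k(2)[of m] that by (cases "m = n") auto
  hence "periodic_from ?e n" using k(1) unfolding periodic_from_def b by auto
  hence "h \<le> n" unfolding h_def preperiod_length_def by (rule Least_le)
  thus False using n(1) by simp
qed

end
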